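(* Let $A=(a_{kl})_{k,l=1}^d$ be a matrix with entries in $AP(\mathbb{R}^d)$ which is symmetric and coercive (there is $\alpha>0$ with $\langle A(y)v,v\rangle\ge\alpha\|v\|^2$ for all $v\in\mathbb{R}^d$ and a.e. $y\in\mathbb{R}^d$). Let $\xi\in\mathbb{R}^d$. Let $N^\xi_A\in W_A$ satisfy $$\mathcal{M}(AN^\xi_A\cdot V)=-\mathcal{M}(A\xi\cdot V)\quad\text{for all }V\in W_A,$$ and let $N^\xi\in W$ satisfy $$\mathcal{M}(AN^\xi\cdot V)=-\mathcal{M}(A\xi\cdot V)\quad\text{for all }V\in W.$$ Then $N^\xi=N^\xi_A$. In particular, $N^\xi\in(B^2_A(\mathbb{R}^d))^d$ and hence $Mod(N^\xi)\subseteq Mod(A)$.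
   Context: $AP(\mathbb{R}^d)$ is the set of Bohr almost periodic functions: bounded continuous $u:\mathbb{R}^d\to\mathbb{R}$ that are uniform limits of real-valued trigonometric polynomials (finite sums $\sum_jc_je^{iy\cdot\eta_j}$, $\eta_j\in\mathbb{R}^d$). $\mathrm{Trig}(\mathbb{R}^d;\mathbb{R})$ denotes the real-valued trigonometric polynomials. Mean value: $\mathcal{M}(u)=\limsup_{L\to\infty}\frac{1}{|Y_L|}\int_{Y_L}u\,dy$, $Y_L=[-L\pi,L\pi)^d$. $B^2(\mathbb{R}^d)$ is the Hilbert space of functions $u\in L^2_{\rm loc}(\mathbb{R}^d)$ that are limits of trigonometric polynomials in the semi-norm $(\mathcal{M}(|\cdot|^2))^{1/2}$, with $f,g$ identified if $\mathcal{M}(|f-g|^2)=0$, and inner product $\mathcal{M}(f\overline g)$. For an almost periodic function $f$, $\Lambda(f)=\{\xi\in\mathbb{R}^d:\mathcal{M}(fe^{-ix\cdot\xi})\ne0\}$ and $Mod(f)$ is the $\mathbb{Z}$-module generated by $\Lambda(f)$; for a matrix- or vector-valued function, $Mod$ is the $\mathbb{Z}$-module generated by the frequencies $\Lambda$ of all its entries. $W$ is the closure in $(B^2(\mathbb{R}^d))^d$ of $\{\nabla\phi:\phi\in\mathrm{Trig}(\mathbb{R}^d;\mathbb{R})\}$. $\mathrm{Trig}_A(\mathbb{R}^d;\mathbb{R})$ is the set of real trigonometric polynomials whose exponents belong to $Mod(A)$; $B^2_A(\mathbb{R}^d)$ is its closure in $B^2(\mathbb{R}^d)$; $W_A$ is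 the closure in $(B^2(\mathbb{R}^d))^d$ of $\{\nabla\phi:\phi\in\mathrm{Trig}_A(\mathbb{R}^d;\mathbb{R})\}$. Equality $N^\xi=N^\xi_A$ is equality in $(B^2(\mathbb{R}^d))^d$. *)

theory Defs
  imports "HOL-Analysis.Analysis"
begin

section \<open>Trigonometric polynomials and Bohr almost periodic functions\<close>

definition ctrig :: "(real ^ 'd) set \<Rightarrow> (real ^ 'd \<Rightarrow> complex) set" where
  "ctrig F = {p. \<exists>S c. finite S \<and> S \<subseteq> F \<and> p = (\<lambda>y. \<Sum>\<eta>\<in>S. c \<eta> * exp (\<i> * complex_of_real (y \<bullet> \<eta>)))}"

definition trig :: "(real ^ 'd) set \<Rightarrow> (real ^ 'd \<Rightarrow> real) set" where
  "trig F = {\<phi>. (\<lambda>y. complex_of_real (\<phi> y)) \<in> ctrig F}"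

definition AP :: "(real ^ 'd \<Rightarrow> real) set" where
  "AP = {u. continuous_on UNIV u \<and> bounded (range u) \<and>
            (\<exists>p. (\<forall>n. p n \<in> trig UNIV) \<and> uniform_limit UNIV p u sequentially)}"

section \<open>Mean values\<close>

definition cube :: "real \<Rightarrow> (real ^ 'd) set" where
  "cube L = {y. \<forall>k. - L * pi \<le> y $ k \<and> y $ k < L * pi}"

text \<open>The value is extended real, so that an infinite mean of a nonnegative function is not
  confused with a finite one.\<close>

definition mean :: "(real ^ 'd \<Rightarrow> real) \<Rightarrow> ereal" where
  "mean u = Limsup at_top
     (\<lambda>L. ereal (1 / measure lebesgue (cube L :: (real ^ 'd) set) * (LINT y : cube L | lebesgue. u y)))"

text \<open>An upper limit only makes sense for real functions; for complex ones it is taken in the real and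
  imaginary parts separately. Whenever the averages converge (in particular for products of two
  elements of \<open>B2\<close>) this is their limit.\<close>

definition cmean :: "(real ^ 'd \<Rightarrow> complex) \<Rightarrow> complex" where
  "cmean u = Complex (real_of_ereal (mean (\<lambda>y. Re (u y)))) (real_of_ereal (mean (\<lambda>y. Im (u y))))"

section \<open>The Besicovitch space\<close>

text \<open>Elements of \<open>B2\<close> are represented by functions; the identification of functions at seminorm
  distance zero is the relation \<open>B2_eq\<close>. Accordingly all closures below are closures for the seminorm
  and are invariant under \<open>B2_eq\<close>.\<close>

definition B2_dist_sq :: "(real ^ 'd \<Rightarrow> complex) \<Rightarrow> (real ^ 'd \<Rightarrow> complex) \<Rightarrow> ereal" where
  "B2_dist_sq f g = mean (\<lambda>y. (cmod (f y - g y))\<^sup>2)"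

definition B2_eq :: "(real ^ 'd \<Rightarrow> complex) \<Rightarrow> (real ^ 'd \<Rightarrow> complex) \<Rightarrow> bool" where
  "B2_eq f g \<longleftrightarrow> B2_dist_sq f g = 0"

definition L2_loc :: "(real ^ 'd \<Rightarrow> complex) set" where
  "L2_loc = {f. f \<in> borel_measurable lebesgue \<and>
                (\<forall>K. compact K \<longrightarrow> set_integrable lebesgue K (\<lambda>y. (cmod (f y))\<^sup>2))}"

definition B2 :: "(real ^ 'd \<Rightarrow> complex) set" where
  "B2 = {f \<in> L2_loc. \<forall>e>0. \<exists>p\<in>ctrig UNIV. B2_dist_sq f p < ereal (e\<^sup>2)}"

text \<open>The closure in \<open>B2\<close> of the real trigonometric polynomials with exponents in \<open>F\<close>.\<close>

definition B2_sub :: "(real ^ 'd) set \<Rightarrow> (real ^ 'd \<Rightarrow> complex) set" where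
  "B2_sub F = {f \<in> B2. \<forall>e>0. \<exists>\<phi>\<in>trig F. B2_dist_sq f (\<lambda>y. complex_of_real (\<phi> y)) < ereal (e\<^sup>2)}"

definition gradients :: "(real ^ 'd) set \<Rightarrow> (real ^ 'd \<Rightarrow> real ^ 'd) set" where
  "gradients F = {G. \<exists>\<phi>\<in>trig F. \<forall>y. GDERIV \<phi> y :> G y}"

text \<open>The closure, in the product of \<open>d\<close> copies of \<open>B2\<close>, of the gradients of real trigonometric
  polynomials with exponents in \<open>F\<close>.\<close>

definition W :: "(real ^ 'd) set \<Rightarrow> (real ^ 'd \<Rightarrow> complex ^ 'd) set" where
  "W F = {V. (\<forall>k. (\<lambda>y. V y $ k) \<in> B2) \<and>
             (\<forall>e>0. \<exists>G\<in>gradients F.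
                (\<Sum>k\<in>UNIV. B2_dist_sq (\<lambda>y. V y $ k) (\<lambda>y. complex_of_real (G y $ k))) < ereal (e\<^sup>2))}"

section \<open>Frequencies\<close>

definition Lam :: "(real ^ 'd \<Rightarrow> complex) \<Rightarrow> (real ^ 'd) set" where
  "Lam f = {\<xi>. cmean (\<lambda>x. f x * exp (- \<i> * complex_of_real (x \<bullet> \<xi>))) \<noteq> 0}"

definition int_span :: "(real ^ 'd) set \<Rightarrow> (real ^ 'd) set" where
  "int_span = module.span (\<lambda>(n::int) x. real_of_int n *\<^sub>R x)"

definition Mod_vec :: "(real ^ 'd \<Rightarrow> complex ^ 'd) \<Rightarrow> (real ^ 'd) set" where
  "Mod_vec N = int_span (\<Union>k. Lam (\<lambda>y. N y $ k))"

definition Mod_mat :: "(real ^ 'd \<Rightarrow> real ^ 'd ^ 'd) \<Rightarrow> (real ^ 'd) set" where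
  "Mod_mat A = int_span (\<Union>k. \<Union>l. Lam (\<lambda>y. complex_of_real (A y $ k $ l)))"

section \<open>The corrector equation\<close>

text \<open>The product \<open>\<cdot>\<close> in \<open>AN \<cdot> V\<close> is bilinear; since elements of \<open>W\<close> are real-valued up to
  \<open>B2_eq\<close>, conjugating one factor would not change its mean.\<close>

definition cdot :: "complex ^ 'd \<Rightarrow> complex ^ 'd \<Rightarrow> complex" where
  "cdot v w = (\<Sum>k\<in>UNIV. v $ k * w $ k)"

definition cvec :: "real ^ 'd \<Rightarrow> complex ^ 'd" where
  "cvec v = (\<chi> k. complex_of_real (v $ k))"

definition cmat :: "real ^ 'd ^ 'd \<Rightarrow> complex ^ 'd ^ 'd" where
  "cmat = map_matrix complex_of_real"

end

theory Submission
  imports Defs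
begin

text \<open>The flux \<open>A (NA + \<xi>)\<close> only contains frequencies of the module of \<open>A\<close>, because this module is a group
  that contains the frequencies of both factors. A real trigonometric polynomial splits into a part with
  frequencies in the module and a part with frequencies outside; the flux is orthogonal in the mean to
  the gradient of the second part, and to that of the first part by the equation for \<open>NA\<close>. Hence \<open>NA\<close>
  solves the equation tested with all gradients (\<open>module_corrector_tests_all_gradients\<close>), just like \<open>N\<close>,
  and the difference \<open>D = N - NA\<close> satisfies that \<open>A D\<close> is orthogonal to every gradient. As \<open>D\<close> is itself a
  limit of gradients, coercivity forces its mean square to vanish (\<open>energy_bound\<close>, \<open>energy_estimate\<close>).
  The statements about approximation and frequencies then pass from \<open>NA\<close> to \<open>N\<close>.

  Orthogonality rests on \<open>has_mean_product\<close>: the mean of \<open>a f\<close> times a wave exists, for \<open>a\<close> bounded and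
  \<open>f\<close> a limit of trigonometric polynomials, as soon as the Fourier coefficients of \<open>a\<close> at the shifted
  frequencies exist, and it vanishes if they do. Waves themselves have mean zero unless they are constant
  (\<open>has_mean_wave\<close>).

  All means are handled as limits of averages over cubes (\<open>has_mean\<close>), which are additive. Their
  existence has to be proved each time, by approximation with trigonometric polynomials
  (\<open>has_mean_approx\<close>).\<close>

section \<open>Averages over large cubes\<close>

definition avg :: "real \<Rightarrow> (real ^ 'd \<Rightarrow> 'b) \<Rightarrow> 'b::{banach, second_countable_topology}" where
  "avg L f = (1 / measure lebesgue (cube L :: (real ^ 'd) set)) *\<^sub>R (LINT y : cube L | lebesgue. f y)"

definition loc_integrable :: "(real ^ 'd \<Rightarrow> 'b::{banach, second_countable_topology}) \<Rightarrow> bool" where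
  "loc_integrable f \<longleftrightarrow> (\<forall>L. set_integrable lebesgue (cube L) f)"

text \<open>A genuine limit of the averages, as opposed to the upper limit in \<open>mean\<close>. Upper limits are not
  additive, and \<open>real_of_ereal\<close> sends an infinite one to zero, so means can be added, and compared
  with \<open>cmean\<close>, only where the limit is known to exist.\<close>
definition has_mean :: "(real ^ 'd \<Rightarrow> complex) \<Rightarrow> complex \<Rightarrow> bool" where
  "has_mean f m \<longleftrightarrow> loc_integrable f \<and> ((\<lambda>L. avg L f) \<longlongrightarrow> m) at_top"

lemma cube_bounds: "box (\<chi> k. - L * pi) (\<chi> k. L * pi) \<subseteq> cube L" "cube L \<subseteq> cbox (\<chi> k. - L * pi) (\<chi> k. L * pi)"
  by (auto simp: cube_def mem_box_cart less_imp_le)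

lemma cube_borel [measurable]: "cube L \<in> sets borel"
  unfolding cube_def by measurable

lemma cube_lebesgue [measurable]: "cube L \<in> sets lebesgue"
  using cube_borel by auto

lemma cube_fmeasurable: "(cube L :: (real ^ 'd) set) \<in> fmeasurable lebesgue"
  by (rule fmeasurableI2[OF _ cube_bounds(2)]) auto

lemma measure_box_cart:
  fixes a b :: "real ^ 'd"
  assumes "\<And>k. a $ k \<le> b $ k"
  shows "measure lebesgue (box a b) = (\<Prod>k\<in>UNIV. b $ k - a $ k)"
    and "measure lebesgue (cbox a b) = (\<Prod>k\<in>UNIV. b $ k - a $ k)"
proof -
  have ne: "cbox a b \<noteq> {}" using assms by (auto simp: interval_ne_empty_cart)
  show "measure lebesgue (cbox a b) = (\<Prod>k\<in>UNIV. b $ k - a $ k)"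
    using content_cbox_cart[OF ne] by simp
  then show "measure lebesgue (box a b) = (\<Prod>k\<in>UNIV. b $ k - a $ k)"
    by (simp add: measure_lborel_box_eq measure_lborel_cbox_eq)
qed

lemma measure_cube:
  assumes "L \<ge> 0"
  shows "measure lebesgue (cube L :: (real ^ 'd) set) = (2 * L * pi) ^ CARD('d)"
proof -
  let ?a = "(\<chi> k. - L * pi) :: real ^ 'd" and ?b = "(\<chi> k. L * pi) :: real ^ 'd"
  have le: "?a $ k \<le> ?b $ k" for k using assms by simp
  have "measure lebesgue (box ?a ?b) \<le> measure lebesgue (cube L :: (real ^ 'd) set)"
    by (intro measure_mono_fmeasurable cube_bounds cube_fmeasurable) auto
  moreover have "measure lebesgue (cube L :: (real ^ 'd) set) \<le> measure lebesgue (cbox ?a ?b)"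
    by (intro measure_mono_fmeasurable cube_bounds) auto
  moreover have "(\<Prod>k\<in>(UNIV :: 'd set). ?b $ k - ?a $ k) = (2 * L * pi) ^ CARD('d)"
    by (simp add: mult.assoc)
  ultimately show ?thesis unfolding measure_box_cart[of ?a ?b, OF le] by (metis order.antisym)
qed

lemma measure_cube_pos:
  assumes "L > 0"
  shows "measure lebesgue (cube L :: (real ^ 'd) set) > 0"
proof -
  have "(2 * L * pi) ^ CARD('d) > 0" using assms pi_gt_zero by (simp)
  then show ?thesis using assms measure_cube[of L, where 'd = 'd] by (metis less_imp_le)
qed

lemma avg_add: "loc_integrable f \<Longrightarrow> loc_integrable g \<Longrightarrow> avg L (\<lambda>y. f y + g y) = avg L f + avg L g"
  unfolding avg_def loc_integrable_def by (simp add: scaleR_right_distrib)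

lemma avg_diff: "loc_integrable f \<Longrightarrow> loc_integrable g \<Longrightarrow> avg L (\<lambda>y. f y - g y) = avg L f - avg L g"
  unfolding avg_def loc_integrable_def by (simp add: scaleR_diff_right)

lemma avg_cmult:
  fixes c :: "'b::{real_normed_field, banach, second_countable_topology}"
  shows "avg L (\<lambda>y. c * f y) = c * avg L f"
  unfolding avg_def by simp

lemma avg_mono:
  fixes f g :: "real ^ 'd \<Rightarrow> real"
  assumes "loc_integrable f" "loc_integrable g" "\<And>y. f y \<le> g y"
  shows "avg L f \<le> avg L g"
proof -
  have "(LINT y : cube L | lebesgue. f y) \<le> (LINT y : cube L | lebesgue. g y)"
    using assms by (intro set_integral_mono) (simp_all add: loc_integrable_def)
  then show ?thesis unfolding avg_def real_scaleR_def by (rule mult_left_mono) simp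
qed

lemma norm_avg_le:
  assumes "loc_integrable f"
  shows "norm (avg L f) \<le> avg L (\<lambda>y. norm (f y))"
proof -
  have "norm (LINT y : cube L | lebesgue. f y) \<le> (LINT y : cube L | lebesgue. norm (f y))"
    using assms unfolding loc_integrable_def by (intro set_integral_norm_bound) auto
  then show ?thesis unfolding avg_def by (auto intro!: divide_right_mono)
qed

lemma avg_nonneg: "(\<And>y. 0 \<le> (f y :: real)) \<Longrightarrow> 0 \<le> avg L f"
  unfolding avg_def set_lebesgue_integral_def by (auto intro!: Bochner_Integration.integral_nonneg)

lemma loc_integrable_const [simp]: "loc_integrable (\<lambda>y :: real ^ 'd. c)"
proof -
  have "integrable lebesgue (\<lambda>y. indicator (cube L) (y :: real ^ 'd) *\<^sub>R c)" for L
    using cube_fmeasurable[of L, where 'd = 'd]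
    by (intro integrable_scaleR_left) (simp add: fmeasurable_def integrable_indicator_iff del: emeasure_completion)
  then show ?thesis by (simp add: loc_integrable_def set_integrable_def)
qed

lemma avg_const: "L > 0 \<Longrightarrow> avg L (\<lambda>y :: real ^ 'd. c) = c"
  using measure_cube_pos[of L, where 'd = 'd] cube_fmeasurable[of L, where 'd = 'd] unfolding avg_def
  by (subst set_integral_const) (auto simp: fmeasurable_def simp del: measure_completion emeasure_completion)

lemma loc_integrable_add: "loc_integrable f \<Longrightarrow> loc_integrable g \<Longrightarrow> loc_integrable (\<lambda>y. f y + g y)"
  by (simp add: loc_integrable_def)

lemma loc_integrable_diff: "loc_integrable f \<Longrightarrow> loc_integrable g \<Longrightarrow> loc_integrable (\<lambda>y. f y - g y)"
  by (simp add: loc_integrable_def)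

lemma loc_integrable_cmult:
  fixes c :: "'b::{real_normed_field, banach, second_countable_topology}"
  shows "loc_integrable f \<Longrightarrow> loc_integrable (\<lambda>y. c * f y)"
  by (simp add: loc_integrable_def)

lemma loc_integrable_norm: "loc_integrable f \<Longrightarrow> loc_integrable (\<lambda>y. norm (f y))"
  unfolding loc_integrable_def by (auto intro: set_integrable_norm)

lemma loc_integrable_bound:
  fixes f :: "real ^ 'd \<Rightarrow> 'b::{banach, second_countable_topology}"
    and g :: "real ^ 'd \<Rightarrow> real"
  assumes "f \<in> borel_measurable lebesgue" "loc_integrable g" "\<And>y. norm (f y) \<le> g y"
  shows "loc_integrable f"
  unfolding loc_integrable_def
proof
  fix L
  show "set_integrable lebesgue (cube L) f"
  proof (rule set_integrable_bound)
    show "set_integrable lebesgue (cube L) g" using assms(2) by (simp add: loc_integrable_def)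
    show "set_borel_measurable lebesgue (cube L) f"
      unfolding set_borel_measurable_def using assms(1) by measurable
    show "AE x in lebesgue. x \<in> cube L \<longrightarrow> norm (f x) \<le> norm (g x)"
      using order_trans[OF assms(3) abs_ge_self] by (intro AE_I2 impI) (simp only: real_norm_def)
  qed
qed

lemma loc_integrable_sum:
  "finite I \<Longrightarrow> (\<And>i. i \<in> I \<Longrightarrow> loc_integrable (f i)) \<Longrightarrow> loc_integrable (\<lambda>y. \<Sum>i\<in>I. f i y)"
proof (induction I rule: finite_induct)
  case (insert i I) then show ?case by (simp add: loc_integrable_add)
qed simp

lemma avg_sum:
  "finite I \<Longrightarrow> (\<And>i. i \<in> I \<Longrightarrow> loc_integrable (f i)) \<Longrightarrow> avg L (\<lambda>y. \<Sum>i\<in>I. f i y) = (\<Sum>i\<in>I. avg L (f i))"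
proof (induction I rule: finite_induct)
  case empty then show ?case by (simp add: avg_def)
next
  case (insert i I) then show ?case by (simp add: avg_add loc_integrable_sum)
qed

lemma borel_continuous_lebesgue: "continuous_on UNIV f \<Longrightarrow> f \<in> borel_measurable lebesgue"
  by (simp add: borel_measurable_continuous_onI measurable_completion)

lemma has_mean_add: "has_mean f a \<Longrightarrow> has_mean g b \<Longrightarrow> has_mean (\<lambda>y. f y + g y) (a + b)"
  unfolding has_mean_def by (auto simp: avg_add loc_integrable_add intro: tendsto_add)

lemma has_mean_diff: "has_mean f a \<Longrightarrow> has_mean g b \<Longrightarrow> has_mean (\<lambda>y. f y - g y) (a - b)"
  unfolding has_mean_def by (auto simp: avg_diff loc_integrable_diff intro: tendsto_diff)

lemma has_mean_cmult: "has_mean f a \<Longrightarrow> has_mean (\<lambda>y. c * f y) (c * a)"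
  unfolding has_mean_def by (auto simp: avg_cmult loc_integrable_cmult intro: tendsto_mult_left)

lemma has_mean_const: "has_mean (\<lambda>y. c) c"
proof -
  have "eventually (\<lambda>L. avg L (\<lambda>y :: real ^ 'd. c) = c) at_top"
    using eventually_gt_at_top[of 0] by eventually_elim (rule avg_const)
  then show ?thesis unfolding has_mean_def by (auto intro: tendsto_eventually)
qed

lemma has_mean_sum:
  "finite I \<Longrightarrow> (\<And>i. i \<in> I \<Longrightarrow> has_mean (f i) (m i)) \<Longrightarrow> has_mean (\<lambda>y. \<Sum>i\<in>I. f i y) (\<Sum>i\<in>I. m i)"
proof (induction I rule: finite_induct)
  case empty then show ?case using has_mean_const[of 0] by simp
next
  case (insert i I) then show ?case by (simp add: has_mean_add)
qed

lemma mean_avg: "mean u = Limsup at_top (\<lambda>L. ereal (avg L u))"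
  by (simp add: mean_def avg_def)

lemma mean_eqI: "((\<lambda>L. avg L u) \<longlongrightarrow> m) at_top \<Longrightarrow> mean u = ereal m"
  unfolding mean_avg by (intro lim_imp_Limsup) auto

lemma avg_Re_Im:
  assumes "loc_integrable f"
  shows "avg L (\<lambda>y. Re (f y)) = Re (avg L f)" "avg L (\<lambda>y. Im (f y)) = Im (avg L f)"
    "loc_integrable (\<lambda>y. Re (f y))"
proof -
  have f: "set_integrable lebesgue (cube L) f" for L
    using assms by (simp add: loc_integrable_def)
  have i: "Re (LINT y : cube L | lebesgue. f y) = (LINT y : cube L | lebesgue. Re (f y))"
          "Im (LINT y : cube L | lebesgue. f y) = (LINT y : cube L | lebesgue. Im (f y))" for L
    using f[of L] unfolding set_integrable_def set_lebesgue_integral_def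
    by (simp_all flip: integral_Re integral_Im)
  show "avg L (\<lambda>y. Re (f y)) = Re (avg L f)" "avg L (\<lambda>y. Im (f y)) = Im (avg L f)"
    unfolding avg_def by (simp_all add: i)
  show "loc_integrable (\<lambda>y. Re (f y))"
    unfolding loc_integrable_def
  proof
    fix L show "set_integrable lebesgue (cube L) (\<lambda>y. Re (f y))"
      using integrable_Re[OF f[of L, unfolded set_integrable_def]] by (simp add: set_integrable_def)
  qed
qed

text \<open>Every use of the corrector equations passes through this lemma, which turns them into statements
  about limits.\<close>
lemma cmean_eqI:
  assumes "has_mean f m"
  shows "cmean f = m"
proof -
  have f: "loc_integrable f" and lim: "((\<lambda>L. avg L f) \<longlongrightarrow> m) at_top"
    using assms by (simp_all add: has_mean_def)
  have "mean (\<lambda>y. Re (f y)) = ereal (Re m)"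
    by (rule mean_eqI) (simp add: avg_Re_Im(1)[OF f] tendsto_Re[OF lim])
  moreover have "mean (\<lambda>y. Im (f y)) = ereal (Im m)"
    by (rule mean_eqI) (simp add: avg_Re_Im(2)[OF f] tendsto_Im[OF lim])
  ultimately show ?thesis by (simp add: cmean_def)
qed

section \<open>Plane waves\<close>

definition wave :: "real ^ 'd \<Rightarrow> real ^ 'd \<Rightarrow> complex" where
  "wave \<eta> y = exp (\<i> * complex_of_real (y \<bullet> \<eta>))"

lemma wave_zero [simp]: "wave 0 = (\<lambda>y. 1)"
  by (simp add: wave_def fun_eq_iff)

lemma norm_wave [simp]: "cmod (wave \<eta> y) = 1"
  by (simp add: wave_def)

lemma wave_add: "wave (\<eta> + \<zeta>) y = wave \<eta> y * wave \<zeta> y"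
  by (simp add: wave_def inner_add_right exp_add[symmetric] distrib_left)

lemma cnj_wave: "cnj (wave \<eta> y) = wave (- \<eta>) y"
  by (simp add: wave_def exp_cnj)

lemma continuous_wave: "continuous_on UNIV (wave \<eta>)"
  unfolding wave_def by (intro continuous_intros)

lemma wave_loc_integrable: "loc_integrable (wave \<eta>)"
  by (rule loc_integrable_bound[where g = "\<lambda>y. 1"]) (auto intro: borel_continuous_lebesgue continuous_wave)

text \<open>Translating by the vector \<open>h\<close> with \<open>h \<bullet> \<eta> = pi\<close> changes the sign of the wave. Hence twice its
  integral over a cube is the integral over the part of the cube and of its translate that they do not
  share, a shell whose share of the volume is of order \<open>1 / L\<close>.\<close>
lemma has_mean_wave:
  fixes \<eta> :: "real ^ 'd"
  assumes "\<eta> \<noteq> 0"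
  shows "has_mean (wave \<eta>) 0"
proof -
  obtain k where k: "\<eta> $ k \<noteq> 0" using assms by (auto simp: vec_eq_iff)
  define t where "t = pi / \<eta> $ k"
  define h where "h = (axis k t :: real ^ 'd)"
  have anti: "wave \<eta> (h + y) = - wave \<eta> y" for y
  proof -
    have "h \<bullet> \<eta> = pi" using k by (simp add: h_def t_def inner_axis')
    then show ?thesis by (simp add: wave_def inner_add_left distrib_left exp_add)
  qed
  define Q where "Q L = (cube L :: (real ^ 'd) set)" for L
  \<comment> \<open>\<open>R L\<close> lies in the cube and is mapped into it by the translation. It is open because the cube omits
      its upper faces, and it is shortened at both ends since \<open>t\<close> may have either sign.\<close>
  define R where "R L = box (\<chi> j. - L * pi + (if j = k then \<bar>t\<bar> else 0)) ((\<chi> j. L * pi - (if j = k then \<bar>t\<bar> else 0)) :: real ^ 'd)" for L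
  have bound: "norm (avg L (wave \<eta>)) \<le> \<bar>t\<bar> / (L * pi)" if L: "L > \<bar>t\<bar>" for L
  proof -
    have "L > 0" using L by simp
    have Lt: "2 * L * pi > 2 * \<bar>t\<bar>"
    proof -
      have "L * 1 \<le> L * pi" using \<open>L > 0\<close> pi_gt3 by (intro mult_left_mono) auto
      then show ?thesis using L by simp
    qed
    define P where "P = (2 * L * pi) ^ CARD('d)"
    define w where "w = 2 * \<bar>t\<bar> / (2 * L * pi)"
    have mQ: "measure lborel (Q L) = P"
      using measure_cube[of L, where 'd = 'd] \<open>L > 0\<close> by (simp add: Q_def P_def)
    have mR: "measure lborel (R L) = P * (1 - w)"
    proof -
      have "measure lborel (R L) = (\<Prod>j\<in>UNIV. 2 * L * pi - (if j = k then 2 * \<bar>t\<bar> else 0))"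
        unfolding R_def using \<open>L > 0\<close> Lt
        by (subst measure_box_cart(1)[simplified]) (auto intro!: prod.cong)
      also have "\<dots> = (\<Prod>j\<in>UNIV. 2 * L * pi * (if j = k then 1 - w else 1))"
        using \<open>L > 0\<close> by (intro prod.cong) (auto simp: field_simps w_def)
      also have "\<dots> = P * (1 - w)"
        by (simp add: prod.distrib P_def)
      finally show ?thesis .
    qed
    have Qb: "Q L \<in> sets borel" "R L \<in> sets borel" by (auto simp: Q_def R_def)
    have Qf: "emeasure lborel (Q L) < \<infinity>" "emeasure lborel (R L) < \<infinity>"
      using cube_fmeasurable[of L, where 'd='d] by (auto simp: Q_def R_def fmeasurable_def emeasure_lborel_box_eq)
    have wb: "wave \<eta> \<in> borel_measurable borel" by (intro borel_measurable_continuous_onI continuous_wave)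
    define I where "I = (LINT y | lborel. indicator (Q L) y *\<^sub>R wave \<eta> y)"
    have iQ: "integrable lborel (\<lambda>y. indicator (Q L) y :: real)" "integrable lborel (\<lambda>y. indicator (R L) y :: real)"
      using Qf Qb by auto
    have int: "integrable lborel (\<lambda>y. indicator (Q L) y *\<^sub>R wave \<eta> y)"
      by (rule Bochner_Integration.integrable_bound[OF iQ(1)]) (use Qb wb in auto)
    have shift: "integrable lborel (\<lambda>y. f (h + y))" "(LINT y|lborel. f (h + y)) = (LINT y|lborel. f y)"
      if "integrable lborel f" for f :: "real ^ 'd \<Rightarrow> 'z::{banach, second_countable_topology}"
    proof -
      have "integrable (distr lborel borel ((+) h)) f" "integral\<^sup>L (distr lborel borel ((+) h)) f = integral\<^sup>L lborel f"
        using that by (simp_all add: lborel_distr_plus)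
      moreover have "f \<in> borel_measurable borel" using that by auto
      ultimately show "integrable lborel (\<lambda>y. f (h + y))" "(LINT y|lborel. f (h + y)) = (LINT y|lborel. f y)"
        by (simp_all add: integrable_distr_eq integral_distr)
    qed
    have RQ: "y \<in> Q L" "h + y \<in> Q L" if "y \<in> R L" for y
    proof -
      have *: "- L * pi + (if j = k then \<bar>t\<bar> else 0) < y $ j" "y $ j < L * pi - (if j = k then \<bar>t\<bar> else 0)" for j
        using that by (auto simp: R_def mem_box_cart)
      show "y \<in> Q L" "h + y \<in> Q L"
        unfolding Q_def cube_def mem_Collect_eq
      proof (safe)
        fix j
        show "- L * pi \<le> y $ j" "y $ j < L * pi" "- L * pi \<le> (h + y) $ j" "(h + y) $ j < L * pi"
          using *[of j] by (auto simp: h_def axis_def split: if_splits)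
      qed
    qed
    have "2 *\<^sub>R I = (LINT y|lborel. indicator (Q L) y *\<^sub>R wave \<eta> y - indicator (Q L) (h + y) *\<^sub>R wave \<eta> y)"
    proof -
      have "- I = - (LINT y|lborel. indicator (Q L) (h + y) *\<^sub>R wave \<eta> (h + y))"
        unfolding I_def by (simp add: shift(2)[OF int])
      also have "\<dots> = (LINT y|lborel. indicator (Q L) (h + y) *\<^sub>R wave \<eta> y)"
        by (simp add: anti)
      finally have "I - - I = (LINT y|lborel. indicator (Q L) y *\<^sub>R wave \<eta> y - indicator (Q L) (h + y) *\<^sub>R wave \<eta> y)"
        using int shift(1)[OF int] unfolding I_def anti by (subst Bochner_Integration.integral_diff) auto
      then show ?thesis by (simp add: scaleR_2)
    qed
    also have "norm \<dots> \<le> (LINT y|lborel. indicator (Q L) y + indicator (Q L) (h + y) - 2 * indicator (R L) y)"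
      using int shift(1)[OF int] iQ shift(1)[OF iQ(1)] RQ unfolding anti
      by (intro Bochner_Integration.integral_norm_bound_integral) (auto simp: indicator_def)
    also have "\<dots> = 2 * measure lborel (Q L) - 2 * measure lborel (R L)"
      using iQ shift[OF iQ(1)] Qb by simp
    finally have le: "2 * norm I \<le> 2 * P - 2 * (P * (1 - w))"
      unfolding mQ mR by simp
    have "P > 0" using \<open>L > 0\<close> by (simp add: P_def)
    have "norm I \<le> P * w" using le by (simp add: algebra_simps)
    then have "norm I / P \<le> w"
      using \<open>P > 0\<close> by (simp add: divide_le_eq mult.commute)
    moreover have "avg L (wave \<eta>) = I /\<^sub>R P"
      using \<open>L > 0\<close> wb Qb unfolding avg_def I_def set_lebesgue_integral_def P_def
      by (simp add: mQ[unfolded Q_def P_def] Q_def integral_completion divide_inverse)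
    moreover have "w = \<bar>t\<bar> / (L * pi)" by (simp add: w_def)
    ultimately show ?thesis using \<open>P > 0\<close> by (simp add: divide_inverse mult.commute)
  qed
  have "((\<lambda>L. \<bar>t\<bar> / pi * inverse L) \<longlongrightarrow> \<bar>t\<bar> / pi * 0) at_top"
    by (intro tendsto_intros tendsto_inverse_0_at_top filterlim_ident)
  then have "((\<lambda>L. \<bar>t\<bar> / (L * pi)) \<longlongrightarrow> 0) at_top" by (simp add: field_simps)
  then have "((\<lambda>L. avg L (wave \<eta>)) \<longlongrightarrow> 0) at_top"
    by (rule Lim_null_comparison[rotated]) (use bound in \<open>auto simp: eventually_at_top_dense\<close>)
  then show ?thesis by (simp add: has_mean_def wave_loc_integrable)
qed

section \<open>Existence of means by approximation\<close>

text \<open>A quantitative Cauchy criterion: the means of the approximants form a Cauchy family whose limit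
  is the mean of \<open>f\<close>. The closed set \<open>S\<close> lets one lemma give both the existence of a mean (\<open>S = UNIV\<close>)
  and its vanishing (\<open>S = {0}\<close>).\<close>
lemma has_mean_approx:
  fixes f :: "real ^ 'd \<Rightarrow> complex"
  assumes f: "loc_integrable f" and S: "closed S"
    and approx: "\<And>e. e > 0 \<Longrightarrow> \<exists>g :: real ^ 'd \<Rightarrow> complex. \<exists>m\<in>S. has_mean g m \<and> (\<forall>\<^sub>F L in at_top. dist (avg L f) (avg L g) \<le> e)"
  shows "\<exists>m\<in>S. has_mean f m"
proof -
  have "\<exists>m\<in>S. \<forall>\<^sub>F L in at_top. dist (avg L f) m < 2 * e" if e: "e > 0" for e
  proof -
    obtain g :: "real ^ 'd \<Rightarrow> complex" and m where g: "m \<in> S" "has_mean g m" "\<forall>\<^sub>F L in at_top. dist (avg L f) (avg L g) \<le> e"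
      using approx[OF e] by blast
    have "\<forall>\<^sub>F L in at_top. dist (avg L g) m < e"
      using g(2) e by (simp add: has_mean_def tendsto_iff)
    with g(3) have "\<forall>\<^sub>F L in at_top. dist (avg L f) m < 2 * e"
    proof eventually_elim
      case (elim L)
      then show ?case using dist_triangle[of "avg L f" m "avg L g"] by linarith
    qed
    with g(1) show ?thesis by blast
  qed
  then have "\<forall>n. \<exists>m\<in>S. \<forall>\<^sub>F L in at_top. dist (avg L f) m < 2 * inverse (real (Suc n))"
    by simp
  then obtain m where m: "\<And>n. m n \<in> S" "\<And>n. \<forall>\<^sub>F L in at_top. dist (avg L f) (m n) < 2 * inverse (real (Suc n))"
    by metis
  have close: "dist (m j) (m k) < 2 * inverse (real (Suc j)) + 2 * inverse (real (Suc k))" for j k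
  proof -
    have "\<forall>\<^sub>F L :: real in at_top. dist (m j) (m k) < 2 * inverse (real (Suc j)) + 2 * inverse (real (Suc k))"
      using m(2)[of j] m(2)[of k]
    proof eventually_elim
      case (elim L)
      then show ?case using dist_triangle3[of "m j" "m k" "avg L f"] by linarith
    qed
    then show ?thesis by simp
  qed
  have small: "\<exists>n. \<forall>j\<ge>n. 2 * inverse (real (Suc j)) < e" if "e > 0" for e
  proof -
    have "((\<lambda>n. 2 * inverse (real (Suc n))) \<longlonglongrightarrow> 2 * 0)"
      by (intro tendsto_intros LIMSEQ_inverse_real_of_nat)
    then have "\<forall>\<^sub>F n in sequentially. 2 * inverse (real (Suc n)) < e"
      using that by (intro order_tendstoD(2)) auto
    then show ?thesis by (simp add: eventually_sequentially)
  qed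
  have "Cauchy m"
  proof (rule metric_CauchyI)
    fix e :: real assume "e > 0"
    then obtain n where "\<forall>j\<ge>n. 2 * inverse (real (Suc j)) < e / 2" using small[of "e/2"] by auto
    then have "dist (m j) (m k) < e" if "j \<ge> n" "k \<ge> n" for j k
    proof -
      have "2 * inverse (real (Suc j)) < e / 2" "2 * inverse (real (Suc k)) < e / 2"
        using \<open>\<forall>j\<ge>n. 2 * inverse (real (Suc j)) < e / 2\<close> that by blast+
      then show ?thesis using close[of j k] by linarith
    qed
    then show "\<exists>M. \<forall>j\<ge>M. \<forall>k\<ge>M. dist (m j) (m k) < e" by blast
  qed
  then obtain l where l: "m \<longlonglongrightarrow> l" using Cauchy_convergent convergent_def by blast
  have "l \<in> S" using S m(1) l closed_sequentially by blast
  moreover have "((\<lambda>L. avg L f) \<longlongrightarrow> l) at_top"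
  proof (rule tendstoI)
    fix e :: real assume "e > 0"
    then obtain n where n: "\<forall>j\<ge>n. 2 * inverse (real (Suc j)) < e / 2" using small[of "e/2"] by auto
    have "\<forall>\<^sub>F j in sequentially. dist (m j) l < e / 2"
      using tendstoD[OF l, of "e / 2"] \<open>e > 0\<close> by simp
    then obtain N where "\<forall>j\<ge>N. dist (m j) l < e / 2" by (auto simp: eventually_sequentially)
    with n obtain j where j: "2 * inverse (real (Suc j)) < e / 2" "dist (m j) l < e / 2"
      using max.cobounded1[of n N] max.cobounded2[of N n] by blast
    show "\<forall>\<^sub>F L in at_top. dist (avg L f) l < e"
      using m(2)[of j]
    proof eventually_elim
      case (elim L)
      then show ?case using j dist_triangle[of "avg L f" l "m j"] by linarith
    qed
  qed
  ultimately show ?thesis using f by (auto simp: has_mean_def)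
qed

section \<open>Trigonometric polynomials and the Besicovitch seminorm\<close>

lemma ctrig_wave_iff:
  "p \<in> ctrig F \<longleftrightarrow> (\<exists>S c. finite S \<and> S \<subseteq> F \<and> p = (\<lambda>y. \<Sum>\<eta>\<in>S. c \<eta> * wave \<eta> y))"
  by (simp add: ctrig_def wave_def)

lemma ctrigI: "finite S \<Longrightarrow> S \<subseteq> F \<Longrightarrow> (\<lambda>y. \<Sum>\<eta>\<in>S. c \<eta> * wave \<eta> y) \<in> ctrig F"
  by (auto simp: ctrig_wave_iff)

lemma ctrig_mono: "F \<subseteq> F' \<Longrightarrow> ctrig F \<subseteq> ctrig F'"
  by (auto simp: ctrig_def)

lemma ctrig_const: "0 \<in> F \<Longrightarrow> (\<lambda>y. c) \<in> ctrig F"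
  using ctrigI[of "{0}" F "\<lambda>_. c"] by simp

lemma ctrig_add:
  assumes "p \<in> ctrig F" "q \<in> ctrig F"
  shows "(\<lambda>y. p y + q y) \<in> ctrig F"
proof -
  obtain S c T d where S: "finite S" "S \<subseteq> F" "p = (\<lambda>y. \<Sum>\<eta>\<in>S. c \<eta> * wave \<eta> y)"
    and T: "finite T" "T \<subseteq> F" "q = (\<lambda>y. \<Sum>\<eta>\<in>T. d \<eta> * wave \<eta> y)"
    using assms by (auto simp: ctrig_wave_iff)
  let ?c = "\<lambda>\<eta>. (if \<eta> \<in> S then c \<eta> else 0)" and ?d = "\<lambda>\<eta>. (if \<eta> \<in> T then d \<eta> else 0)"
  have "p = (\<lambda>y. \<Sum>\<eta>\<in>S \<union> T. ?c \<eta> * wave \<eta> y)" "q = (\<lambda>y. \<Sum>\<eta>\<in>S \<union> T. ?d \<eta> * wave \<eta> y)"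
    unfolding S(3) T(3) by (rule ext, rule sum.mono_neutral_cong_left; use S(1) T(1) in auto)+
  then have "(\<lambda>y. p y + q y) = (\<lambda>y. \<Sum>\<eta>\<in>S \<union> T. (?c \<eta> + ?d \<eta>) * wave \<eta> y)"
    by (simp add: sum.distrib distrib_right)
  then show ?thesis using ctrigI[of "S \<union> T" F "\<lambda>\<eta>. ?c \<eta> + ?d \<eta>"] S T by simp
qed

lemma ctrig_continuous_bounded:
  assumes "p \<in> ctrig F"
  shows "continuous_on UNIV p" and "\<exists>C\<ge>0. \<forall>y. cmod (p y) \<le> C"
proof -
  obtain S c where S: "finite S" "p = (\<lambda>y. \<Sum>\<eta>\<in>S. c \<eta> * wave \<eta> y)"
    using assms by (auto simp: ctrig_wave_iff)
  show "continuous_on UNIV p" unfolding S by (intro continuous_intros continuous_wave)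
  have "cmod (p y) \<le> (\<Sum>\<eta>\<in>S. cmod (c \<eta>))" for y
    unfolding S by (rule order_trans[OF norm_sum]) (simp add: norm_mult)
  then show "\<exists>C\<ge>0. \<forall>y. cmod (p y) \<le> C" by (metis norm_ge_zero order_trans)
qed

lemma L2_loc_loc_integrable_sq:
  assumes "f \<in> L2_loc"
  shows "loc_integrable (\<lambda>y. (cmod (f y))\<^sup>2)"
  unfolding loc_integrable_def
proof
  fix L
  show "set_integrable lebesgue (cube L) (\<lambda>y. (cmod (f y))\<^sup>2)"
    by (rule set_integrable_subset[OF _ _ cube_bounds(2)]) (use assms in \<open>auto simp: L2_loc_def\<close>)
qed

lemma L2_loc_measurable: "f \<in> L2_loc \<Longrightarrow> f \<in> borel_measurable lebesgue"
  by (simp add: L2_loc_def)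

lemma L2_loc_loc_integrable:
  assumes "f \<in> L2_loc"
  shows "loc_integrable f"
proof (rule loc_integrable_bound)
  show "f \<in> borel_measurable lebesgue" using assms by (rule L2_loc_measurable)
  show "loc_integrable (\<lambda>y. 1 + (cmod (f y))\<^sup>2)"
    using assms by (intro loc_integrable_add L2_loc_loc_integrable_sq) auto
  show "norm (f y) \<le> 1 + (cmod (f y))\<^sup>2" for y
    using sum_squares_bound[of "cmod (f y)" 1] by (simp add: power2_eq_square) (use norm_ge_zero[of "f y"] in linarith)
qed

lemma cmod_diff_sq_le: "(cmod (u - v))\<^sup>2 \<le> 2 * (cmod u)\<^sup>2 + 2 * (cmod v)\<^sup>2"
proof -
  have "(cmod (u - v))\<^sup>2 \<le> (cmod u + cmod v)\<^sup>2"
    by (intro power_mono norm_triangle_ineq4) auto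
  also have "\<dots> \<le> 2 * (cmod u)\<^sup>2 + 2 * (cmod v)\<^sup>2"
    using sum_squares_bound[of "cmod u" "cmod v"] by (simp add: power2_sum)
  finally show ?thesis .
qed

lemma L2_loc_diff:
  fixes f g :: "real ^ 'd \<Rightarrow> complex"
  assumes "f \<in> L2_loc" "g \<in> L2_loc"
  shows "(\<lambda>y. f y - g y) \<in> L2_loc"
  unfolding L2_loc_def mem_Collect_eq
proof (intro conjI allI impI)
  have [measurable]: "f \<in> borel_measurable lebesgue" "g \<in> borel_measurable lebesgue"
    using assms by (auto simp: L2_loc_def)
  show "(\<lambda>y. f y - g y) \<in> borel_measurable lebesgue" by measurable
  fix K :: "(real ^ 'd) set" assume K: "compact K"
  show "set_integrable lebesgue K (\<lambda>y. (cmod (f y - g y))\<^sup>2)"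
  proof (rule set_integrable_bound)
    show "set_integrable lebesgue K (\<lambda>y. 2 * (cmod (f y))\<^sup>2 + 2 * (cmod (g y))\<^sup>2)"
      using assms K unfolding L2_loc_def
      by (intro set_integral_add set_integrable_mult_right) auto
    have [measurable]: "K \<in> sets lebesgue" using K lmeasurable_compact by blast
    show "set_borel_measurable lebesgue K (\<lambda>y. (cmod (f y - g y))\<^sup>2)"
      unfolding set_borel_measurable_def by measurable
    show "AE x in lebesgue. x \<in> K \<longrightarrow> norm ((cmod (f x - g x))\<^sup>2) \<le> norm (2 * (cmod (f x))\<^sup>2 + 2 * (cmod (g x))\<^sup>2)"
    proof (intro AE_I2 impI)
      fix x
      show "norm ((cmod (f x - g x))\<^sup>2) \<le> norm (2 * (cmod (f x))\<^sup>2 + 2 * (cmod (g x))\<^sup>2)"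
        using cmod_diff_sq_le[of "f x" "g x"] by simp
    qed
  qed
qed

lemma ctrig_L2_loc:
  fixes p :: "real ^ 'd \<Rightarrow> complex"
  assumes "p \<in> ctrig F"
  shows "p \<in> L2_loc"
  unfolding L2_loc_def mem_Collect_eq
proof (intro conjI allI impI)
  have c: "continuous_on UNIV p" using assms by (rule ctrig_continuous_bounded)
  then show "p \<in> borel_measurable lebesgue" by (rule borel_continuous_lebesgue)
  fix K :: "(real ^ 'd) set" assume K: "compact K"
  obtain b where ab: "K \<subseteq> cbox (- b) b"
    using bounded_subset_cbox_symmetric[OF compact_imp_bounded[OF K]] by auto
  have "continuous_on (cbox (- b) b) (\<lambda>y. (cmod (p y))\<^sup>2)"
    by (intro continuous_intros continuous_on_subset[OF c]) auto
  then have "set_integrable lebesgue (cbox (- b) b) (\<lambda>y. (cmod (p y))\<^sup>2)"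
    by (rule absolutely_integrable_continuous)
  then show "set_integrable lebesgue K (\<lambda>y. (cmod (p y))\<^sup>2)"
    by (rule set_integrable_subset) (use ab lmeasurable_compact[OF K] in auto)
qed

lemma avg_diff_sq_le:
  assumes "f \<in> L2_loc" "g \<in> L2_loc"
  shows "avg L (\<lambda>y. (cmod (f y - g y))\<^sup>2) \<le> 2 * avg L (\<lambda>y. (cmod (f y))\<^sup>2) + 2 * avg L (\<lambda>y. (cmod (g y))\<^sup>2)"
proof -
  have i: "loc_integrable (\<lambda>y. 2 * (cmod (f y))\<^sup>2)" "loc_integrable (\<lambda>y. 2 * (cmod (g y))\<^sup>2)"
    using assms by (auto intro!: loc_integrable_cmult L2_loc_loc_integrable_sq)
  have "avg L (\<lambda>y. (cmod (f y - g y))\<^sup>2) \<le> avg L (\<lambda>y. 2 * (cmod (f y))\<^sup>2 + 2 * (cmod (g y))\<^sup>2)"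
    using i by (intro avg_mono L2_loc_loc_integrable_sq L2_loc_diff assms loc_integrable_add cmod_diff_sq_le)
  also have "\<dots> = 2 * avg L (\<lambda>y. (cmod (f y))\<^sup>2) + 2 * avg L (\<lambda>y. (cmod (g y))\<^sup>2)"
    by (simp only: avg_add[OF i] avg_cmult)
  finally show ?thesis .
qed

lemma B2_dist_sq_lessD:
  "B2_dist_sq f g < ereal (e\<^sup>2) \<Longrightarrow> \<forall>\<^sub>F L in at_top. avg L (\<lambda>y. (cmod (f y - g y))\<^sup>2) < e\<^sup>2"
  unfolding B2_dist_sq_def mean_avg by (drule Limsup_lessD) simp

lemma B2_dist_sq_refl: "B2_dist_sq f f = 0"
  by (simp add: B2_dist_sq_def mean_def Limsup_const)

lemma B2_dist_sq_nonneg: "0 \<le> B2_dist_sq f g"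
proof -
  have "Limsup at_top (\<lambda>L::real. 0 :: ereal) \<le> B2_dist_sq f g"
    unfolding B2_dist_sq_def mean_avg by (intro Limsup_mono always_eventually) (auto intro: avg_nonneg)
  then show ?thesis by (simp add: Limsup_const)
qed

text \<open>The \<open>L1\<close> mean is dominated by the \<open>L2\<close> mean: average \<open>2 e t \<le> t\<^sup>2 + e\<^sup>2\<close>.\<close>
lemma avg_less_of_avg_sq:
  assumes f: "f \<in> L2_loc" and "e > 0" "L > 0" and less: "avg L (\<lambda>y. (cmod (f y))\<^sup>2) < e\<^sup>2"
  shows "avg L (\<lambda>y. cmod (f y)) < e"
proof -
  let ?g = "\<lambda>y. inverse (2 * e) * (cmod (f y))\<^sup>2 + e / 2"
  have "avg L (\<lambda>y. cmod (f y)) \<le> avg L ?g"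
  proof (rule avg_mono)
    show "loc_integrable (\<lambda>y. cmod (f y))" using f by (intro loc_integrable_norm L2_loc_loc_integrable)
    show "loc_integrable ?g"
      using f by (intro loc_integrable_add loc_integrable_cmult L2_loc_loc_integrable_sq) auto
    show "cmod (f y) \<le> ?g y" for y
      using \<open>e > 0\<close> zero_le_power2[of "cmod (f y) - e"]
      by (simp add: field_simps power2_eq_square)
  qed
  also have "\<dots> = inverse (2 * e) * avg L (\<lambda>y. (cmod (f y))\<^sup>2) + e / 2"
    using f \<open>L > 0\<close> by (subst avg_add)
      (auto intro: loc_integrable_cmult L2_loc_loc_integrable_sq simp only: avg_cmult avg_const loc_integrable_const)
  also have "\<dots> < inverse (2 * e) * e\<^sup>2 + e / 2"
    using less \<open>e > 0\<close> by (intro add_strict_right_mono mult_strict_left_mono) auto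
  also have "\<dots> = e" using \<open>e > 0\<close> by (simp add: power2_eq_square field_simps)
  finally show ?thesis .
qed

lemma ctrig_B2:
  assumes "p \<in> ctrig F"
  shows "p \<in> B2"
  unfolding B2_def mem_Collect_eq
proof (intro conjI allI impI)
  show "p \<in> L2_loc" using assms by (rule ctrig_L2_loc)
  fix e :: real assume "e > 0"
  then have "B2_dist_sq p p < ereal (e\<^sup>2)" by (simp add: B2_dist_sq_refl)
  with assms ctrig_mono[of F UNIV] show "\<exists>q\<in>ctrig UNIV. B2_dist_sq p q < ereal (e\<^sup>2)" by auto
qed

section \<open>Means of products\<close>

text \<open>Closeness is measured in the \<open>L1\<close> mean: multiplication by a bounded function preserves it, and it
  controls means. The closure contains both the Besicovitch closures and the Bohr almost periodic functions.\<close>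
definition mean_closure :: "(real ^ 'd) set \<Rightarrow> (real ^ 'd \<Rightarrow> complex) set" where
  "mean_closure F = {f \<in> borel_measurable lebesgue. loc_integrable f \<and>
     (\<forall>e>0. \<exists>p\<in>ctrig F. \<forall>\<^sub>F L in at_top. avg L (\<lambda>y. cmod (f y - p y)) < e)}"

lemma mean_closureI_L2:
  assumes f: "f \<in> L2_loc"
    and approx: "\<And>e. e > 0 \<Longrightarrow> \<exists>p\<in>ctrig F. B2_dist_sq f p < ereal (e\<^sup>2)"
  shows "f \<in> mean_closure F"
  unfolding mean_closure_def mem_Collect_eq
proof (intro conjI allI impI)
  show "f \<in> borel_measurable lebesgue" "loc_integrable f"
    using f by (auto intro: L2_loc_measurable L2_loc_loc_integrable)
  fix e :: real assume "e > 0"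
  then obtain p where p: "p \<in> ctrig F" "B2_dist_sq f p < ereal (e\<^sup>2)" using approx by blast
  have "\<forall>\<^sub>F L in at_top. avg L (\<lambda>y. cmod (f y - p y)) < e"
    using B2_dist_sq_lessD[OF p(2)] eventually_gt_at_top[of 0]
    by eventually_elim (rule avg_less_of_avg_sq[OF L2_loc_diff[OF f ctrig_L2_loc[OF p(1)]] \<open>e > 0\<close>])
  then show "\<exists>p\<in>ctrig F. \<forall>\<^sub>F L in at_top. avg L (\<lambda>y. cmod (f y - p y)) < e"
    using p(1) by (rule bexI)
qed

lemma ctrig_mean_closure:
  assumes "p \<in> ctrig F"
  shows "p \<in> mean_closure F"
proof (rule mean_closureI_L2[OF ctrig_L2_loc[OF assms]])
  fix e :: real assume "e > 0"
  then have "B2_dist_sq p p < ereal (e\<^sup>2)" by (simp add: B2_dist_sq_refl)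
  with assms show "\<exists>q\<in>ctrig F. B2_dist_sq p q < ereal (e\<^sup>2)" by blast
qed

text \<open>If \<open>p\<close> is a trigonometric polynomial close to \<open>f\<close>, then \<open>a p\<close> times a wave is a combination of the
  functions \<open>a\<close> times a wave whose means are given, and its averages over large cubes are close to those
  of the product with \<open>f\<close> because \<open>a\<close> is bounded. So only Fourier coefficients of \<open>a\<close> at frequencies
  shifted by \<open>F\<close> enter, and these are what the definition of \<open>Lam\<close> speaks about.\<close>
lemma has_mean_product:
  fixes a f :: "real ^ 'd \<Rightarrow> complex"
  assumes a: "continuous_on UNIV a" "\<And>y. cmod (a y) \<le> C"
    and f: "f \<in> mean_closure F" and S: "S = {0} \<or> S = UNIV"
    and waves: "\<And>\<gamma>. \<gamma> \<in> F \<Longrightarrow> \<exists>m\<in>S. has_mean (\<lambda>y. a y * wave (\<gamma> + \<eta>) y) m"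
  shows "\<exists>m\<in>S. has_mean (\<lambda>y. a y * f y * wave \<eta> y) m"
proof (rule has_mean_approx)
  have "C \<ge> 0" using a(2)[of 0] norm_ge_zero order_trans by blast
  have am: "a \<in> borel_measurable lebesgue" "wave \<eta> \<in> borel_measurable lebesgue"
    using a(1) continuous_wave by (auto intro: borel_continuous_lebesgue)
  have int: "loc_integrable (\<lambda>y. a y * h y * wave \<eta> y)"
    if h: "h \<in> borel_measurable lebesgue" "loc_integrable h" for h
  proof (rule loc_integrable_bound)
    show "(\<lambda>y. a y * h y * wave \<eta> y) \<in> borel_measurable lebesgue"
      using am h by measurable
    show "loc_integrable (\<lambda>y. C * cmod (h y))"
      using h by (intro loc_integrable_cmult loc_integrable_norm)
    show "norm (a y * h y * wave \<eta> y) \<le> C * cmod (h y)" for y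
      by (simp add: norm_mult a mult_right_mono)
  qed
  have fm: "f \<in> borel_measurable lebesgue" "loc_integrable f"
    using f by (auto simp: mean_closure_def)
  then show "loc_integrable (\<lambda>y. a y * f y * wave \<eta> y)" by (rule int)
  show "closed S" using S by auto
  fix e :: real assume "e > 0"
  then have "e / (C + 1) > 0" using \<open>C \<ge> 0\<close> by simp
  then obtain p where p: "p \<in> ctrig F" "\<forall>\<^sub>F L in at_top. avg L (\<lambda>y. cmod (f y - p y)) < e / (C + 1)"
    using f unfolding mean_closure_def by blast
  then obtain T c where T: "finite T" "T \<subseteq> F" "p = (\<lambda>y. \<Sum>\<gamma>\<in>T. c \<gamma> * wave \<gamma> y)"
    by (auto simp: ctrig_wave_iff)
  obtain m where m: "\<And>\<gamma>. \<gamma> \<in> F \<Longrightarrow> m \<gamma> \<in> S \<and> has_mean (\<lambda>y. a y * wave (\<gamma> + \<eta>) y) (m \<gamma>)"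
    using waves by metis
  have "has_mean (\<lambda>y. \<Sum>\<gamma>\<in>T. c \<gamma> * (a y * wave (\<gamma> + \<eta>) y)) (\<Sum>\<gamma>\<in>T. c \<gamma> * m \<gamma>)"
    using T m by (intro has_mean_sum has_mean_cmult) auto
  also have "(\<lambda>y. \<Sum>\<gamma>\<in>T. c \<gamma> * (a y * wave (\<gamma> + \<eta>) y)) = (\<lambda>y. a y * p y * wave \<eta> y)"
    by (simp add: T(3) wave_add sum_distrib_left sum_distrib_right mult_ac)
  finally have "has_mean (\<lambda>y. a y * p y * wave \<eta> y) (\<Sum>\<gamma>\<in>T. c \<gamma> * m \<gamma>)" .
  moreover have "(\<Sum>\<gamma>\<in>T. c \<gamma> * m \<gamma>) \<in> S"
    using S m T(2) by (auto intro!: sum.neutral)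
  moreover have "\<forall>\<^sub>F L in at_top. dist (avg L (\<lambda>y. a y * f y * wave \<eta> y)) (avg L (\<lambda>y. a y * p y * wave \<eta> y)) \<le> e"
    using p(2)
  proof eventually_elim
    case (elim L)
    have pm: "p \<in> borel_measurable lebesgue" "loc_integrable p"
      using p(1) ctrig_L2_loc L2_loc_measurable L2_loc_loc_integrable by blast+
    have d: "loc_integrable (\<lambda>y. f y - p y)" "loc_integrable (\<lambda>y. a y * (f y - p y) * wave \<eta> y)"
      using fm pm by (auto intro!: loc_integrable_diff int)
    have "avg L (\<lambda>y. a y * f y * wave \<eta> y) - avg L (\<lambda>y. a y * p y * wave \<eta> y)
        = avg L (\<lambda>y. a y * (f y - p y) * wave \<eta> y)"
      using int[OF fm] int[OF pm] by (simp add: avg_diff[symmetric] algebra_simps)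
    then have "dist (avg L (\<lambda>y. a y * f y * wave \<eta> y)) (avg L (\<lambda>y. a y * p y * wave \<eta> y))
        \<le> avg L (\<lambda>y. cmod (a y * (f y - p y) * wave \<eta> y))"
      using norm_avg_le[OF d(2)] by (simp add: dist_norm)
    also have "\<dots> \<le> avg L (\<lambda>y. C * cmod (f y - p y))"
      using d a(2) by (intro avg_mono loc_integrable_norm loc_integrable_cmult)
        (auto simp: norm_mult intro: mult_right_mono)
    also have "\<dots> = C * avg L (\<lambda>y. cmod (f y - p y))" by (rule avg_cmult)
    also have "\<dots> \<le> (C + 1) * (e / (C + 1))"
      using elim \<open>C \<ge> 0\<close> by (intro mult_mono avg_nonneg) auto
    finally show ?case using \<open>C \<ge> 0\<close> by simp
  qed
  ultimately show "\<exists>g :: real ^ 'd \<Rightarrow> complex. \<exists>m\<in>S. has_mean g m \<and>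
      (\<forall>\<^sub>F L in at_top. dist (avg L (\<lambda>y. a y * f y * wave \<eta> y)) (avg L g) \<le> e)"
    by (intro exI[of _ "\<lambda>y. a y * p y * wave \<eta> y"] bexI conjI)
qed

lemma AP_continuous_bounded:
  assumes "a \<in> AP"
  shows "continuous_on UNIV (\<lambda>y. complex_of_real (a y))" "\<exists>C. \<forall>y. cmod (complex_of_real (a y)) \<le> C"
proof -
  show "continuous_on UNIV (\<lambda>y. complex_of_real (a y))"
    using assms by (intro continuous_intros) (simp add: AP_def)
  show "\<exists>C. \<forall>y. cmod (complex_of_real (a y)) \<le> C"
    using assms by (auto simp: AP_def bounded_iff)
qed

lemma AP_mean_closure:
  fixes a :: "real ^ 'd \<Rightarrow> real"
  assumes "a \<in> AP"
  shows "(\<lambda>y. complex_of_real (a y)) \<in> mean_closure UNIV"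
  unfolding mean_closure_def mem_Collect_eq
proof (intro conjI allI impI)
  show m: "(\<lambda>y. complex_of_real (a y)) \<in> borel_measurable lebesgue"
    by (intro borel_continuous_lebesgue AP_continuous_bounded assms)
  obtain C where C: "\<And>y. cmod (complex_of_real (a y)) \<le> C" using AP_continuous_bounded[OF assms] by blast
  show int: "loc_integrable (\<lambda>y. complex_of_real (a y))"
    by (rule loc_integrable_bound[OF m _ C]) simp
  fix e :: real assume "e > 0"
  obtain p where p: "\<And>n. p n \<in> trig UNIV" "uniform_limit UNIV p a sequentially"
    using assms by (auto simp: AP_def)
  have "\<forall>\<^sub>F n in sequentially. \<forall>y\<in>UNIV. dist (p n y) (a y) < e / 2"
    using uniform_limitD[OF p(2), of "e / 2"] \<open>e > 0\<close> by simp
  then obtain n where n: "\<And>y. dist (p n y) (a y) < e / 2"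
    by (auto simp: eventually_sequentially)
  have ct: "(\<lambda>y. complex_of_real (p n y)) \<in> ctrig UNIV" using p(1) by (simp add: trig_def)
  have "avg L (\<lambda>y. cmod (complex_of_real (a y) - complex_of_real (p n y))) < e" if "L > 0" for L
  proof -
    have "avg L (\<lambda>y. cmod (complex_of_real (a y) - complex_of_real (p n y))) \<le> avg L (\<lambda>y :: real ^ 'd. e / 2)"
    proof (rule avg_mono)
      show "loc_integrable (\<lambda>y. cmod (complex_of_real (a y) - complex_of_real (p n y)))"
        using ct by (intro loc_integrable_norm loc_integrable_diff int L2_loc_loc_integrable ctrig_L2_loc)
      show "cmod (complex_of_real (a y) - complex_of_real (p n y)) \<le> e / 2" for y
        using n[of y] by (simp flip: of_real_diff add: dist_real_def abs_minus_commute)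
    qed simp
    then show ?thesis using avg_const[OF that, of "e / 2", where 'd = 'd] \<open>e > 0\<close> by simp
  qed
  then have "\<forall>\<^sub>F L in at_top. avg L (\<lambda>y. cmod (complex_of_real (a y) - complex_of_real (p n y))) < e"
    using eventually_gt_at_top[of 0] by (rule eventually_mono[rotated])
  then show "\<exists>p\<in>ctrig UNIV. \<forall>\<^sub>F L in at_top. avg L (\<lambda>y. cmod (complex_of_real (a y) - p y)) < e"
    using ct by (intro bexI)
qed

lemma mean_closure_has_coefficient:
  assumes "f \<in> mean_closure F"
  shows "\<exists>m. has_mean (\<lambda>y. f y * wave \<eta> y) m"
proof -
  have "\<exists>m\<in>UNIV. has_mean (\<lambda>y. 1 * f y * wave \<eta> y) m"
  proof (rule has_mean_product[OF _ _ assms])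
    show "\<exists>m\<in>UNIV. has_mean (\<lambda>y. 1 * wave (\<gamma> + \<eta>) y) m" for \<gamma>
      using has_mean_wave[of "\<gamma> + \<eta>"] has_mean_const[of 1, where 'a = 'a] by (cases "\<gamma> + \<eta> = 0") auto
  qed auto
  then show ?thesis by simp
qed

lemma mean_closure_coefficient_zero:
  assumes "f \<in> mean_closure F" "- \<eta> \<notin> F"
  shows "has_mean (\<lambda>y. f y * wave \<eta> y) 0"
proof -
  have "\<exists>m\<in>{0}. has_mean (\<lambda>y. 1 * f y * wave \<eta> y) m"
  proof (rule has_mean_product[OF _ _ assms(1)])
    show "\<exists>m\<in>{0}. has_mean (\<lambda>y. 1 * wave (\<gamma> + \<eta>) y) m" if "\<gamma> \<in> F" for \<gamma>
      using has_mean_wave[of "\<gamma> + \<eta>"] assms(2) that by (auto simp: add_eq_0_iff2)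
  qed auto
  then show ?thesis by simp
qed

lemma Lam_iff: "\<xi> \<in> Lam f \<longleftrightarrow> cmean (\<lambda>y. f y * wave (- \<xi>) y) \<noteq> 0"
  by (simp add: Lam_def wave_def)

text \<open>A coefficient at a frequency outside \<open>F\<close> vanishes on all approximants, hence in the limit.\<close>
lemma Lam_mean_closure:
  assumes "f \<in> mean_closure F"
  shows "Lam f \<subseteq> F"
proof
  fix \<xi> assume "\<xi> \<in> Lam f"
  then show "\<xi> \<in> F"
    using mean_closure_coefficient_zero[OF assms, of "- \<xi>", THEN cmean_eqI] by (auto simp: Lam_iff)
qed

lemma has_mean_ctrig_test:
  assumes p: "p \<in> ctrig H" and S: "S = {0} \<or> S = UNIV"
    and waves: "\<And>\<eta>. \<eta> \<in> H \<Longrightarrow> \<exists>m\<in>S. has_mean (\<lambda>y. h y * wave \<eta> y) m"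
  shows "\<exists>m\<in>S. has_mean (\<lambda>y. h y * p y) m"
proof -
  obtain T c where T: "finite T" "T \<subseteq> H" "p = (\<lambda>y. \<Sum>\<eta>\<in>T. c \<eta> * wave \<eta> y)"
    using p by (auto simp: ctrig_wave_iff)
  obtain m where m: "\<And>\<eta>. \<eta> \<in> H \<Longrightarrow> m \<eta> \<in> S \<and> has_mean (\<lambda>y. h y * wave \<eta> y) (m \<eta>)"
    using waves by metis
  have "has_mean (\<lambda>y. \<Sum>\<eta>\<in>T. c \<eta> * (h y * wave \<eta> y)) (\<Sum>\<eta>\<in>T. c \<eta> * m \<eta>)"
    using T m by (intro has_mean_sum has_mean_cmult) auto
  also have "(\<lambda>y. \<Sum>\<eta>\<in>T. c \<eta> * (h y * wave \<eta> y)) = (\<lambda>y. h y * p y)"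
    by (simp add: T(3) sum_distrib_left mult_ac)
  finally show ?thesis
    using S m T(2) by (intro bexI[of _ "\<Sum>\<eta>\<in>T. c \<eta> * m \<eta>"]) (auto intro!: sum.neutral)
qed

lemma has_mean_AP_product:
  assumes a: "a \<in> AP" and f: "f \<in> mean_closure F" and p: "p \<in> ctrig H"
  shows "\<exists>m. has_mean (\<lambda>y. complex_of_real (a y) * f y * p y) m"
proof -
  obtain C where C: "\<And>y. cmod (complex_of_real (a y)) \<le> C" using AP_continuous_bounded[OF a] by blast
  have "\<exists>m\<in>UNIV. has_mean (\<lambda>y. complex_of_real (a y) * f y * p y) m"
  proof (intro has_mean_ctrig_test[OF p] has_mean_product[OF _ C f])
    show "continuous_on UNIV (\<lambda>y. complex_of_real (a y))" by (rule AP_continuous_bounded[OF a])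
    show "\<exists>m\<in>UNIV. has_mean (\<lambda>y. complex_of_real (a y) * wave (\<gamma> + \<eta>) y) m" for \<gamma> \<eta>
      using mean_closure_has_coefficient[OF AP_mean_closure[OF a]] by blast
  qed auto
  then show ?thesis by simp
qed

lemma has_mean_AP_product_zero:
  assumes a: "a \<in> AP" and f: "f \<in> mean_closure F" and p: "p \<in> ctrig H"
    and disj: "\<And>\<gamma> \<eta>. \<gamma> \<in> F \<Longrightarrow> \<eta> \<in> H \<Longrightarrow> - (\<gamma> + \<eta>) \<notin> Lam (\<lambda>y. complex_of_real (a y))"
  shows "has_mean (\<lambda>y. complex_of_real (a y) * f y * p y) 0"
proof -
  obtain C where C: "\<And>y. cmod (complex_of_real (a y)) \<le> C" using AP_continuous_bounded[OF a] by blast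
  have "\<exists>m\<in>{0}. has_mean (\<lambda>y. complex_of_real (a y) * f y * p y) m"
  proof (intro has_mean_ctrig_test[OF p] has_mean_product[OF _ C f])
    show "continuous_on UNIV (\<lambda>y. complex_of_real (a y))" by (rule AP_continuous_bounded[OF a])
    fix \<gamma> \<eta> assume "\<eta> \<in> H" "\<gamma> \<in> F"
    then have z: "cmean (\<lambda>y. complex_of_real (a y) * wave (\<gamma> + \<eta>) y) = 0"
      using disj[of \<gamma> \<eta>] by (simp add: Lam_iff del: minus_add_distrib)
    obtain m where m: "has_mean (\<lambda>y. complex_of_real (a y) * wave (\<gamma> + \<eta>) y) m"
      using mean_closure_has_coefficient[OF AP_mean_closure[OF a]] by blast
    then have "m = 0" using z cmean_eqI by metis
    then show "\<exists>m\<in>{0}. has_mean (\<lambda>y. complex_of_real (a y) * wave (\<gamma> + \<eta>) y) m"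
      using m by simp
  qed auto
  then show ?thesis by simp
qed

section \<open>Integer spans\<close>

lemma module_int_scaleR: "module (\<lambda>(n::int) x :: real ^ 'd. real_of_int n *\<^sub>R x)"
  by unfold_locales (auto simp: scaleR_add_right scaleR_add_left)

lemma int_span_superset: "S \<subseteq> int_span S"
  unfolding int_span_def using module.span_superset[OF module_int_scaleR] .

lemma int_span_zero: "0 \<in> int_span S"
  unfolding int_span_def using module.span_zero[OF module_int_scaleR] .

lemma int_span_add: "x \<in> int_span S \<Longrightarrow> y \<in> int_span S \<Longrightarrow> x + y \<in> int_span S"
  unfolding int_span_def using module.span_add[OF module_int_scaleR] .

lemma int_span_neg: "x \<in> int_span S \<Longrightarrow> - x \<in> int_span S"
  unfolding int_span_def using module.span_neg[OF module_int_scaleR] .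

lemma int_span_minimal: "S \<subseteq> int_span T \<Longrightarrow> int_span S \<subseteq> int_span T"
  unfolding int_span_def
  using module.span_minimal[OF module_int_scaleR _ module.subspace_span[OF module_int_scaleR]] .

section \<open>Gradients of trigonometric polynomials\<close>

lemma wave_has_derivative:
  "(wave \<eta> has_derivative (\<lambda>h. (\<i> * complex_of_real (h \<bullet> \<eta>)) * wave \<eta> y)) (at y)"
proof -
  have "((\<lambda>y. \<i> * complex_of_real (y \<bullet> \<eta>)) has_derivative (\<lambda>h. \<i> * complex_of_real (h \<bullet> \<eta>))) (at y)"
    by (auto intro!: derivative_eq_intros)
  from has_derivative_compose[OF this DERIV_exp[THEN has_field_derivative_imp_has_derivative]]
  show ?thesis unfolding wave_def by (simp add: mult.commute)
qed

lemma ctrig_has_derivative: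
  assumes "finite S"
  shows "((\<lambda>y. \<Sum>\<eta>\<in>S. c \<eta> * wave \<eta> y) has_derivative
     (\<lambda>h. \<Sum>\<eta>\<in>S. c \<eta> * ((\<i> * complex_of_real (h \<bullet> \<eta>)) * wave \<eta> y))) (at y)"
  by (intro has_derivative_sum has_derivative_mult_right wave_has_derivative)

lemma trig_has_gradient:
  assumes "\<phi> \<in> trig F"
  shows "\<exists>G\<in>gradients F. \<forall>y. GDERIV \<phi> y :> G y"
proof -
  obtain S c where S: "finite S" "S \<subseteq> F" "(\<lambda>y. complex_of_real (\<phi> y)) = (\<lambda>y. \<Sum>\<eta>\<in>S. c \<eta> * wave \<eta> y)"
    using assms by (auto simp: trig_def ctrig_wave_iff)
  define G where "G y = (\<Sum>\<eta>\<in>S. Re (c \<eta> * \<i> * wave \<eta> y) *\<^sub>R \<eta>)" for y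
  have Re: "\<phi> = (\<lambda>y. Re (\<Sum>\<eta>\<in>S. c \<eta> * wave \<eta> y))"
    by (rule ext) (simp flip: fun_cong[OF S(3)])
  have "GDERIV \<phi> y :> G y" for y
  proof -
    have "(\<phi> has_derivative
       (\<lambda>h. Re (\<Sum>\<eta>\<in>S. c \<eta> * ((\<i> * complex_of_real (h \<bullet> \<eta>)) * wave \<eta> y)))) (at y)"
      unfolding Re by (rule bounded_linear.has_derivative[OF bounded_linear_Re ctrig_has_derivative[OF S(1)]])
    moreover have "Re (\<Sum>\<eta>\<in>S. c \<eta> * ((\<i> * complex_of_real (h \<bullet> \<eta>)) * wave \<eta> y)) = h \<bullet> G y" for h
    proof -
      have "c \<eta> * ((\<i> * complex_of_real (h \<bullet> \<eta>)) * wave \<eta> y) = (h \<bullet> \<eta>) *\<^sub>R (c \<eta> * \<i> * wave \<eta> y)" for \<eta>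
        by (simp add: scaleR_conv_of_real mult_ac)
      then show ?thesis by (simp add: G_def inner_sum_right mult.commute)
    qed
    ultimately show ?thesis by (simp add: gderiv_def)
  qed
  then show ?thesis using assms unfolding gradients_def by blast
qed

text \<open>The polynomial is real along with its gradient, but \<open>F\<close> need not be closed under
  negation, so real parts cannot be taken. Differentiating the complex expansion, and using uniqueness of the derivative, gives an
  expansion of the components with the same exponents.\<close>
lemma gradients_component:
  assumes "G \<in> gradients F"
  shows "(\<lambda>y. complex_of_real (G y $ k)) \<in> ctrig F"
proof -
  obtain \<phi> where \<phi>: "\<phi> \<in> trig F" "\<And>y. GDERIV \<phi> y :> G y" using assms by (auto simp: gradients_def)
  obtain S c where S: "finite S" "S \<subseteq> F" "(\<lambda>y. complex_of_real (\<phi> y)) = (\<lambda>y. \<Sum>\<eta>\<in>S. c \<eta> * wave \<eta> y)"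
    using \<phi>(1) by (auto simp: trig_def ctrig_wave_iff)
  have "complex_of_real (G y $ k) = (\<Sum>\<eta>\<in>S. (c \<eta> * \<i> * complex_of_real (\<eta> $ k)) * wave \<eta> y)" for y
  proof -
    have "((\<lambda>y. complex_of_real (\<phi> y)) has_derivative (\<lambda>h. complex_of_real (h \<bullet> G y))) (at y)"
      using \<phi>(2)[of y] unfolding gderiv_def by (rule bounded_linear.has_derivative[OF bounded_linear_of_real])
    moreover have "((\<lambda>y. complex_of_real (\<phi> y)) has_derivative
       (\<lambda>h. \<Sum>\<eta>\<in>S. c \<eta> * ((\<i> * complex_of_real (h \<bullet> \<eta>)) * wave \<eta> y))) (at y)"
      unfolding S(3) by (rule ctrig_has_derivative[OF S(1)])
    ultimately have "(\<lambda>h. complex_of_real (h \<bullet> G y)) = (\<lambda>h. \<Sum>\<eta>\<in>S. c \<eta> * ((\<i> * complex_of_real (h \<bullet> \<eta>)) * wave \<eta> y))"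
      by (rule has_derivative_unique)
    from fun_cong[OF this, of "axis k 1"] show ?thesis
      by (simp add: inner_axis' mult_ac)
  qed
  then show ?thesis using ctrigI[OF S(1,2), of "\<lambda>\<eta>. c \<eta> * \<i> * complex_of_real (\<eta> $ k)"] by simp
qed

lemma gradients_mono: "F \<subseteq> F' \<Longrightarrow> gradients F \<subseteq> gradients F'"
  using ctrig_mono[of F F'] unfolding gradients_def trig_def by blast

text \<open>Conjugation negates exponents, hence the symmetry of \<open>F\<close>.\<close>
lemma Re_ctrig:
  assumes F: "\<And>x. x \<in> F \<Longrightarrow> - x \<in> F" and p: "p \<in> ctrig F"
  shows "(\<lambda>y. Re (p y)) \<in> trig F"
proof -
  obtain S c where S: "finite S" "S \<subseteq> F" "p = (\<lambda>y. \<Sum>\<eta>\<in>S. c \<eta> * wave \<eta> y)"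
    using p by (auto simp: ctrig_wave_iff)
  have "complex_of_real (Re (p y)) = (\<Sum>\<eta>\<in>S. (c \<eta> / 2) * wave \<eta> y)
      + (\<Sum>\<eta>\<in>uminus ` S. (cnj (c (- \<eta>)) / 2) * wave \<eta> y)" for y
  proof -
    have "(\<Sum>\<eta>\<in>uminus ` S. (cnj (c (- \<eta>)) / 2) * wave \<eta> y) = cnj (p y) / 2"
      by (subst sum.reindex) (auto simp: S(3) cnj_wave sum_divide_distrib)
    moreover have "(\<Sum>\<eta>\<in>S. (c \<eta> / 2) * wave \<eta> y) = p y / 2"
      by (simp add: S(3) sum_divide_distrib)
    ultimately show ?thesis by (simp add: complex_eq_iff)
  qed
  moreover have "(\<lambda>y. (\<Sum>\<eta>\<in>S. (c \<eta> / 2) * wave \<eta> y)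
      + (\<Sum>\<eta>\<in>uminus ` S. (cnj (c (- \<eta>)) / 2) * wave \<eta> y)) \<in> ctrig F"
    using S F by (intro ctrig_add ctrigI) auto
  ultimately show ?thesis by (simp add: trig_def)
qed

text \<open>Truncating the expansion of a real polynomial to \<open>\<Gamma>\<close> and to its complement gives two complex
  polynomials whose real parts add up to it. The real parts have their exponents in the same two sets
  because both are closed under negation.\<close>
lemma gradients_split:
  assumes \<Gamma>: "\<And>x. x \<in> \<Gamma> \<Longrightarrow> - x \<in> \<Gamma>" and G: "G \<in> gradients UNIV"
  obtains G1 G2 where "G1 \<in> gradients \<Gamma>" "G2 \<in> gradients (- \<Gamma>)" "\<And>y. G y = G1 y + G2 y"
proof -
  obtain \<phi> where \<phi>: "\<phi> \<in> trig UNIV" "\<And>y. GDERIV \<phi> y :> G y" using G by (auto simp: gradients_def)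
  obtain S c where S: "finite S" "(\<lambda>y. complex_of_real (\<phi> y)) = (\<lambda>y. \<Sum>\<eta>\<in>S. c \<eta> * wave \<eta> y)"
    using \<phi>(1) by (auto simp: trig_def ctrig_wave_iff)
  define \<phi>1 where "\<phi>1 y = Re (\<Sum>\<eta>\<in>S \<inter> \<Gamma>. c \<eta> * wave \<eta> y)" for y
  define \<phi>2 where "\<phi>2 y = Re (\<Sum>\<eta>\<in>S - \<Gamma>. c \<eta> * wave \<eta> y)" for y
  have "\<phi>1 \<in> trig \<Gamma>" "\<phi>2 \<in> trig (- \<Gamma>)"
  proof -
    show "\<phi>1 \<in> trig \<Gamma>"
      unfolding \<phi>1_def using S(1) \<Gamma> by (intro Re_ctrig ctrigI) auto
    have "- x \<in> - \<Gamma>" if "x \<in> - \<Gamma>" for x using \<Gamma>[of "- x"] that by auto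
    then show "\<phi>2 \<in> trig (- \<Gamma>)"
      unfolding \<phi>2_def using S(1) by (intro Re_ctrig ctrigI) auto
  qed
  then obtain G1 G2 where G12: "G1 \<in> gradients \<Gamma>" "\<And>y. GDERIV \<phi>1 y :> G1 y"
      "G2 \<in> gradients (- \<Gamma>)" "\<And>y. GDERIV \<phi>2 y :> G2 y"
    using trig_has_gradient[of \<phi>1 \<Gamma>] trig_has_gradient[of \<phi>2 "- \<Gamma>"] by blast
  have "G y = G1 y + G2 y" for y
  proof -
    have "\<phi> y = Re (\<Sum>\<eta>\<in>S. c \<eta> * wave \<eta> y)" for y by (simp flip: fun_cong[OF S(2)])
    then have "\<phi> = (\<lambda>y. \<phi>1 y + \<phi>2 y)"
      by (simp add: \<phi>1_def \<phi>2_def fun_eq_iff sum.Int_Diff[OF S(1), of _ \<Gamma>])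
    then have "GDERIV \<phi> y :> (G1 y + G2 y)" using GDERIV_add[OF G12(2,4)] by simp
    then have "(\<lambda>h. h \<bullet> G y) = (\<lambda>h. h \<bullet> (G1 y + G2 y))"
      using \<phi>(2)[of y] unfolding gderiv_def by (rule has_derivative_unique[rotated])
    then show ?thesis by (intro vector_eq_ldot[THEN iffD1]) (metis inner_commute)
  qed
  then show thesis using G12 that by blast
qed

section \<open>Testing the corrector equations with gradients\<close>

lemma W_L2_loc: "V \<in> W F \<Longrightarrow> (\<lambda>y. V y $ k) \<in> L2_loc"
  by (simp add: W_def B2_def)

lemma W_approx:
  assumes "V \<in> W F" "e > 0"
  obtains G where "G \<in> gradients F" "\<And>k. B2_dist_sq (\<lambda>y. V y $ k) (\<lambda>y. complex_of_real (G y $ k)) < ereal (e\<^sup>2)"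
proof -
  obtain G where G: "G \<in> gradients F"
    "(\<Sum>k\<in>UNIV. B2_dist_sq (\<lambda>y. V y $ k) (\<lambda>y. complex_of_real (G y $ k))) < ereal (e\<^sup>2)"
    using assms by (auto simp: W_def)
  have "B2_dist_sq (\<lambda>y. V y $ k) (\<lambda>y. complex_of_real (G y $ k))
     \<le> (\<Sum>k\<in>UNIV. B2_dist_sq (\<lambda>y. V y $ k) (\<lambda>y. complex_of_real (G y $ k)))" for k
    by (rule sum_nonneg_leq_bound[OF _ _ refl]) (auto intro: B2_dist_sq_nonneg)
  with G that show thesis by (meson order_le_less_trans)
qed

lemma W_mean_closure:
  assumes "V \<in> W F"
  shows "(\<lambda>y. V y $ k) \<in> mean_closure F"
proof (rule mean_closureI_L2[OF W_L2_loc[OF assms]])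
  fix e :: real assume "e > 0"
  then obtain G where "G \<in> gradients F" "\<And>k. B2_dist_sq (\<lambda>y. V y $ k) (\<lambda>y. complex_of_real (G y $ k)) < ereal (e\<^sup>2)"
    using W_approx[OF assms] by metis
  then show "\<exists>p\<in>ctrig F. B2_dist_sq (\<lambda>y. V y $ k) p < ereal (e\<^sup>2)"
    by (intro bexI[of _ "\<lambda>y. complex_of_real (G y $ k)"] gradients_component)
qed

lemma gradients_W:
  assumes "G \<in> gradients F"
  shows "(\<lambda>y. cvec (G y)) \<in> W F"
  unfolding W_def mem_Collect_eq
proof (intro conjI allI impI)
  show "(\<lambda>y. cvec (G y) $ k) \<in> B2" for k
    using ctrig_B2[OF gradients_component[OF assms]] by (simp add: cvec_def)
  fix e :: real assume "e > 0"
  then have "(\<Sum>k\<in>UNIV. B2_dist_sq (\<lambda>y. cvec (G y) $ k) (\<lambda>y. complex_of_real (G y $ k))) < ereal (e\<^sup>2)"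
    by (simp add: cvec_def B2_dist_sq_refl)
  with assms show "\<exists>G'\<in>gradients F. (\<Sum>k\<in>UNIV. B2_dist_sq (\<lambda>y. cvec (G y) $ k) (\<lambda>y. complex_of_real (G' y $ k))) < ereal (e\<^sup>2)"
    by (intro bexI[of _ G])
qed

lemma cdot_cmat_cvec:
  "cdot (cmat M *v w) (cvec g) = (\<Sum>k\<in>UNIV. \<Sum>l\<in>UNIV. complex_of_real (M $ k $ l) * w $ l * complex_of_real (g $ k))"
  by (simp add: cdot_def cvec_def cmat_def map_matrix_def matrix_vector_mult_def sum_distrib_right)

lemma cvec_matrix_vector: "cvec (M *v x) = cmat M *v cvec x"
  by (simp add: vec_eq_iff cvec_def cmat_def map_matrix_def matrix_vector_mult_def)

lemma cvec_add: "cvec (x + y) = cvec x + cvec y" and cvec_diff: "cvec (x - y) = cvec x - cvec y"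
  by (simp_all add: vec_eq_iff cvec_def)

lemma cdot_add_left: "cdot (v + v') w = cdot v w + cdot v' w"
  and cdot_diff_left: "cdot (v - v') w = cdot v w - cdot v' w"
  and cdot_add_right: "cdot v (w + w') = cdot v w + cdot v w'"
  and cdot_diff_right: "cdot v (w - w') = cdot v w - cdot v w'"
  by (simp_all add: cdot_def algebra_simps sum.distrib sum_subtractf)

lemma has_mean_flux:
  assumes A: "\<And>k l. (\<lambda>y. A y $ k $ l) \<in> AP" and w: "\<And>l. (\<lambda>y. w y $ l) \<in> mean_closure F"
    and G: "G \<in> gradients H"
  shows "\<exists>m. has_mean (\<lambda>y. cdot (cmat (A y) *v w y) (cvec (G y))) m"
proof -
  have "\<exists>m. has_mean (\<lambda>y. complex_of_real (A y $ k $ l) * w y $ l * complex_of_real (G y $ k)) m" for k l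
    using has_mean_AP_product[OF A w gradients_component[OF G]] .
  then have "has_mean (\<lambda>y. complex_of_real (A y $ k $ l) * w y $ l * complex_of_real (G y $ k))
      (cmean (\<lambda>y. complex_of_real (A y $ k $ l) * w y $ l * complex_of_real (G y $ k)))" for k l
    using cmean_eqI by fastforce
  then have "has_mean (\<lambda>y. cdot (cmat (A y) *v w y) (cvec (G y)))
      (\<Sum>k\<in>UNIV. \<Sum>l\<in>UNIV. cmean (\<lambda>y. complex_of_real (A y $ k $ l) * w y $ l * complex_of_real (G y $ k)))"
    unfolding cdot_cmat_cvec by (rule has_mean_sum[OF finite has_mean_sum[OF finite]])
  then show ?thesis ..
qed

text \<open>The frequencies of the flux lie in the module, so it is orthogonal to every gradient with
  frequencies outside of it: if \<open>\<gamma>\<close> is in the module and \<open>\<eta>\<close> is not, then \<open>- (\<gamma> + \<eta>)\<close> is not, and the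
  corresponding Fourier coefficients of the matrix vanish.\<close>
lemma has_mean_flux_zero:
  assumes A: "\<And>k l. (\<lambda>y. A y $ k $ l) \<in> AP" and w: "\<And>l. (\<lambda>y. w y $ l) \<in> mean_closure (Mod_mat A)"
    and G: "G \<in> gradients (- Mod_mat A)"
  shows "has_mean (\<lambda>y. cdot (cmat (A y) *v w y) (cvec (G y))) 0"
proof -
  have "has_mean (\<lambda>y. complex_of_real (A y $ k $ l) * w y $ l * complex_of_real (G y $ k)) 0" for k l
  proof (rule has_mean_AP_product_zero[OF A w gradients_component[OF G]])
    fix \<gamma> \<eta> assume \<gamma>: "\<gamma> \<in> Mod_mat A" "\<eta> \<in> - Mod_mat A"
    show "- (\<gamma> + \<eta>) \<notin> Lam (\<lambda>y. complex_of_real (A y $ k $ l))"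
    proof
      assume "- (\<gamma> + \<eta>) \<in> Lam (\<lambda>y. complex_of_real (A y $ k $ l))"
      then have "- (\<gamma> + \<eta>) \<in> Mod_mat A"
        unfolding Mod_mat_def by (intro int_span_superset[THEN subsetD]) blast
      then have "- (- (\<gamma> + \<eta>) + \<gamma>) \<in> Mod_mat A"
        unfolding Mod_mat_def by (rule int_span_neg[OF int_span_add[OF _ \<gamma>(1)[unfolded Mod_mat_def]]])
      with \<gamma>(2) show False by simp
    qed
  qed
  then have "has_mean (\<lambda>y. cdot (cmat (A y) *v w y) (cvec (G y))) (\<Sum>k\<in>(UNIV::'a set). \<Sum>l\<in>(UNIV::'a set). 0)"
    unfolding cdot_cmat_cvec by (rule has_mean_sum[OF finite has_mean_sum[OF finite]])
  then show ?thesis by simp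
qed

text \<open>Adding the right-hand side to the corrector puts the equation in divergence form, which makes
  it homogeneous, so that two solutions can be subtracted.\<close>
lemma corrector_flux_mean_zero:
  fixes A :: "real ^ 'd \<Rightarrow> real ^ 'd ^ 'd"
  assumes A: "\<And>k l. (\<lambda>y. A y $ k $ l) \<in> AP" and M: "M \<in> W F"
    and eq: "\<And>V. V \<in> W F \<Longrightarrow>
          cmean (\<lambda>y. cdot (cmat (A y) *v M y) (V y)) = - cmean (\<lambda>y. cdot (cvec (A y *v \<xi>)) (V y))"
    and G: "G \<in> gradients F"
  shows "has_mean (\<lambda>y. cdot (cmat (A y) *v (M y + cvec \<xi>)) (cvec (G y))) 0"
proof -
  obtain m where m: "has_mean (\<lambda>y. cdot (cmat (A y) *v M y) (cvec (G y))) m"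
    using has_mean_flux[OF A W_mean_closure[OF M] G] by (rule exE)
  have c: "(\<lambda>y :: real ^ 'd. cvec \<xi> $ l) \<in> mean_closure UNIV" for l
    by (intro ctrig_mean_closure ctrig_const) simp
  obtain n where n: "has_mean (\<lambda>y. cdot (cmat (A y) *v cvec \<xi>) (cvec (G y))) n"
    using has_mean_flux[OF A c G] by (rule exE)
  have "cmean (\<lambda>y. cdot (cmat (A y) *v M y) (cvec (G y))) = - cmean (\<lambda>y. cdot (cmat (A y) *v cvec \<xi>) (cvec (G y)))"
    using eq[OF gradients_W[OF G]] unfolding cvec_matrix_vector .
  then have "m + n = 0" unfolding cmean_eqI[OF m] cmean_eqI[OF n] by simp
  have 1: "has_mean (\<lambda>y. cdot (cmat (A y) *v M y) (cvec (G y)) + cdot (cmat (A y) *v cvec \<xi>) (cvec (G y))) (m + n)"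
    by (rule has_mean_add[OF m n])
  have 2: "cdot (cmat (A y) *v (M y + cvec \<xi>)) (cvec (G y)) = cdot (cmat (A y) *v M y) (cvec (G y)) + cdot (cmat (A y) *v cvec \<xi>) (cvec (G y))" for y
    by (simp only: matrix_vector_right_distrib cdot_add_left)
  show ?thesis unfolding 2 using 1 unfolding \<open>m + n = 0\<close> .
qed

text \<open>The heart of the matter: the equation over the module already implies the equation over all
  frequencies. The part of the test gradient inside the module is covered by hypothesis, and the flux
  is orthogonal to the part outside.\<close>
lemma module_corrector_tests_all_gradients:
  assumes A: "\<And>k l. (\<lambda>y. A y $ k $ l) \<in> AP" and M: "M \<in> W (Mod_mat A)"
    and eq: "\<And>V. V \<in> W (Mod_mat A) \<Longrightarrow>
          cmean (\<lambda>y. cdot (cmat (A y) *v M y) (V y)) = - cmean (\<lambda>y. cdot (cvec (A y *v \<xi>)) (V y))"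
    and G: "G \<in> gradients UNIV"
  shows "has_mean (\<lambda>y. cdot (cmat (A y) *v (M y + cvec \<xi>)) (cvec (G y))) 0"
proof -
  have neg: "- x \<in> Mod_mat A" if "x \<in> Mod_mat A" for x
    using that unfolding Mod_mat_def by (rule int_span_neg)
  obtain G1 G2 where G12: "G1 \<in> gradients (Mod_mat A)" "G2 \<in> gradients (- Mod_mat A)" "\<And>y. G y = G1 y + G2 y"
    using gradients_split[OF neg G] by blast
  have c: "(\<lambda>y. cvec \<xi> $ l) \<in> mean_closure (Mod_mat A)" for l
    by (intro ctrig_mean_closure ctrig_const) (simp add: Mod_mat_def int_span_zero)
  have "has_mean (\<lambda>y. cdot (cmat (A y) *v M y) (cvec (G2 y)) + cdot (cmat (A y) *v cvec \<xi>) (cvec (G2 y))) (0 + 0)"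
    by (intro has_mean_add has_mean_flux_zero A W_mean_closure M c G12(2))
  then have "has_mean (\<lambda>y. cdot (cmat (A y) *v (M y + cvec \<xi>)) (cvec (G2 y))) 0"
    by (simp add: matrix_vector_right_distrib cdot_add_left)
  from has_mean_add[OF corrector_flux_mean_zero[OF A M eq G12(1)] this] show ?thesis
    by (simp add: G12(3) cvec_add cdot_add_right)
qed

section \<open>The energy estimate\<close>

lemma norm_vec_sq: "(norm (x :: complex ^ 'd))\<^sup>2 = (\<Sum>k\<in>UNIV. (cmod (x $ k))\<^sup>2)"
  by (simp add: norm_vec_def L2_set_def sum_nonneg)

lemma norm_real_vec_sq: "(norm (x :: real ^ 'd))\<^sup>2 = (\<Sum>k\<in>UNIV. (x $ k)\<^sup>2)"
  by (simp add: norm_vec_def L2_set_def sum_nonneg)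

lemma norm_cvec: "norm (cvec x) = norm x"
  by (simp add: norm_vec_def cvec_def)

lemma cdot_bound: "cmod (cdot v w) \<le> norm v * norm w"
proof -
  have "cmod (cdot v w) \<le> (\<Sum>k\<in>UNIV. \<bar>cmod (v $ k)\<bar> * \<bar>cmod (w $ k)\<bar>)"
    unfolding cdot_def by (rule order_trans[OF norm_sum]) (simp add: norm_mult)
  also have "\<dots> \<le> norm v * norm w"
    unfolding norm_vec_def by (rule L2_set_mult_ineq)
  finally show ?thesis .
qed

lemma norm_cmat_vector_le:
  fixes M :: "real ^ 'd ^ 'd"
  assumes "\<And>k l. \<bar>M $ k $ l\<bar> \<le> b"
  shows "norm (cmat M *v w) \<le> real (CARD('d) * CARD('d)) * b * norm w"
proof -
  have "norm (cmat M *v w) \<le> (\<Sum>k\<in>UNIV. cmod ((cmat M *v w) $ k))"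
    unfolding norm_vec_def by (rule L2_set_le_sum) simp
  also have "\<dots> \<le> (\<Sum>k\<in>(UNIV :: 'd set). \<Sum>l\<in>(UNIV :: 'd set). b * norm w)"
  proof (rule sum_mono)
    fix k
    have "cmod ((cmat M *v w) $ k) \<le> (\<Sum>l\<in>UNIV. \<bar>M $ k $ l\<bar> * cmod (w $ l))"
      unfolding cmat_def map_matrix_def matrix_vector_mult_def
      by simp (rule order_trans[OF norm_sum], simp add: norm_mult)
    also have "\<dots> \<le> (\<Sum>l\<in>(UNIV :: 'd set). b * norm w)"
      using assms by (intro sum_mono mult_mono) (auto simp: Finite_Cartesian_Product.norm_nth_le intro: order_trans[OF abs_ge_zero])
    finally show "cmod ((cmat M *v w) $ k) \<le> (\<Sum>l\<in>(UNIV :: 'd set). b * norm w)" .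
  qed
  finally show ?thesis by (simp add: mult_ac)
qed

lemma Re_cdot_quadratic:
  "Re (cdot (cmat M *v x) x) = (M *v (\<chi> k. Re (x $ k))) \<bullet> (\<chi> k. Re (x $ k)) - (M *v (\<chi> k. Im (x $ k))) \<bullet> (\<chi> k. Im (x $ k))"
  by (simp add: cdot_def cmat_def map_matrix_def matrix_vector_mult_def inner_vec_def sum_subtractf)

text \<open>Coercivity for complex \<open>x\<close> near a real vector \<open>g\<close>. The product \<open>cdot\<close> is bilinear, so the real
  part of the quadratic form is the energy of the real part of \<open>x\<close> minus that of its imaginary part;
  since \<open>g\<close> is real, the imaginary parts of \<open>x\<close> and \<open>x - cvec g\<close> agree. The error made in replacing the second
  factor by \<open>g\<close> is absorbed by Young's inequality, at the price of half of \<open>\<alpha>\<close>. The estimate is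
  pointwise, so it can simply be averaged.\<close>
lemma energy_bound:
  fixes M :: "real ^ 'd ^ 'd" and x :: "complex ^ 'd" and g :: "real ^ 'd"
  assumes \<alpha>: "\<alpha> > 0" and coercive: "\<And>v. (M *v v) \<bullet> v \<ge> \<alpha> * (norm v)\<^sup>2"
    and B: "\<And>w. norm (cmat M *v w) \<le> B * norm w" and "B \<ge> 0"
  shows "\<alpha> / 2 * (norm x)\<^sup>2 \<le> Re (cdot (cmat M *v x) (cvec g)) + (\<alpha> + B + B\<^sup>2 / (2 * \<alpha>)) * (norm (x - cvec g))\<^sup>2"
proof -
  define R where "R = (\<chi> k. Re (x $ k))"
  define I where "I = (\<chi> k. Im (x $ k))"
  define E where "E = x - cvec g"
  have sq: "(norm x)\<^sup>2 = (norm R)\<^sup>2 + (norm I)\<^sup>2"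
    by (simp add: norm_vec_sq norm_real_vec_sq R_def I_def cmod_power2 sum.distrib)
  have IE: "(norm I)\<^sup>2 \<le> (norm E)\<^sup>2"
    unfolding norm_vec_sq norm_real_vec_sq by (intro sum_mono) (simp add: I_def E_def cvec_def cmod_power2)
  have "(M *v I) \<bullet> I = Re (cdot (cmat M *v cvec I) (cvec I))"
    by (simp add: Re_cdot_quadratic) (simp add: cvec_def zero_vec_def[symmetric])
  also have "\<dots> \<le> norm (cmat M *v cvec I) * norm (cvec I)"
    using complex_Re_le_cmod cdot_bound by (rule order_trans)
  also have "\<dots> \<le> B * (norm I)\<^sup>2"
    using mult_right_mono[OF B[of "cvec I"] norm_ge_zero[of "cvec I"]] by (simp add: norm_cvec power2_eq_square)
  finally have I: "(M *v I) \<bullet> I \<le> B * (norm I)\<^sup>2" .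
  have "\<alpha> * (norm x)\<^sup>2 \<le> Re (cdot (cmat M *v x) x) + (\<alpha> + B) * (norm I)\<^sup>2"
    using I coercive[of R] unfolding Re_cdot_quadratic sq by (simp add: R_def[symmetric] I_def[symmetric] algebra_simps)
  moreover have "(\<alpha> + B) * (norm I)\<^sup>2 \<le> (\<alpha> + B) * (norm E)\<^sup>2"
    using IE \<alpha> \<open>B \<ge> 0\<close> by (intro mult_left_mono) auto
  moreover have "Re (cdot (cmat M *v x) x) = Re (cdot (cmat M *v x) (cvec g)) + Re (cdot (cmat M *v x) E)"
    by (simp add: E_def cdot_diff_right)
  moreover have "Re (cdot (cmat M *v x) E) \<le> B * norm x * norm E"
    using order_trans[OF complex_Re_le_cmod cdot_bound] mult_right_mono[OF B norm_ge_zero] order_trans by blast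
  moreover have "B * norm x * norm E \<le> \<alpha> / 2 * (norm x)\<^sup>2 + B\<^sup>2 / (2 * \<alpha>) * (norm E)\<^sup>2"
  proof -
    have "0 \<le> (\<alpha> * norm x - B * norm E)\<^sup>2 / (2 * \<alpha>)" using \<alpha> by simp
    also have "\<dots> = \<alpha> / 2 * (norm x)\<^sup>2 + B\<^sup>2 / (2 * \<alpha>) * (norm E)\<^sup>2 - B * norm x * norm E"
      using \<alpha> by (simp add: power2_eq_square field_simps)
    finally show ?thesis by simp
  qed
  moreover have "(\<alpha> + B + B\<^sup>2 / (2 * \<alpha>)) * (norm E)\<^sup>2 = (\<alpha> + B) * (norm E)\<^sup>2 + B\<^sup>2 / (2 * \<alpha>) * (norm E)\<^sup>2"
    by (rule distrib_right)
  moreover have "\<alpha> * (norm x)\<^sup>2 = \<alpha> / 2 * (norm x)\<^sup>2 + \<alpha> / 2 * (norm x)\<^sup>2" by simp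
  ultimately show ?thesis unfolding E_def[symmetric] by linarith
qed

text \<open>The exceptional set may depend on \<open>v\<close>, but by continuity it is open, and an open null set is
  empty.\<close>
lemma coercive_everywhere:
  fixes A :: "real ^ 'd \<Rightarrow> real ^ 'd ^ 'd"
  assumes cont: "\<And>k l. continuous_on UNIV (\<lambda>y. A y $ k $ l)"
    and ae: "AE y in lebesgue. (A y *v v) \<bullet> v \<ge> c"
  shows "(A y *v v) \<bullet> v \<ge> c"
proof (rule ccontr)
  define S where "S = {y. (A y *v v) \<bullet> v < c}"
  assume "\<not> (A y *v v) \<bullet> v \<ge> c"
  then have "y \<in> S" by (simp add: S_def)
  have cont: "continuous_on UNIV (\<lambda>y. (A y *v v) \<bullet> v)"
    unfolding inner_vec_def matrix_vector_mult_def by (simp, intro continuous_intros assms(1))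
  then have "open S" unfolding S_def by (intro open_Collect_less cont continuous_on_const)
  then have "S \<in> sets lebesgue" by auto
  moreover have "AE y in lebesgue. y \<notin> S" using ae by eventually_elim (simp add: S_def not_less)
  ultimately have "S \<in> null_sets lebesgue" by (simp add: AE_iff_null_sets)
  then have "negligible S" by (simp add: negligible_iff_null_sets)
  with open_not_negligible[OF \<open>open S\<close>] \<open>y \<in> S\<close> show False by blast
qed

lemma AP_entries_bounded:
  fixes A :: "real ^ 'd \<Rightarrow> real ^ 'd ^ 'd"
  assumes "\<And>k l. (\<lambda>y. A y $ k $ l) \<in> AP"
  obtains b where "b \<ge> 0" "\<And>y k l. \<bar>A y $ k $ l\<bar> \<le> b"
proof -
  have "\<exists>C. \<forall>y. \<bar>A y $ k $ l\<bar> \<le> C" for k l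
    using AP_continuous_bounded(2)[OF assms[of k l]] by simp
  then obtain C where C: "\<And>k l y. \<bar>A y $ k $ l\<bar> \<le> C k l" by metis
  have "\<bar>A y $ k $ l\<bar> \<le> (\<Sum>k\<in>UNIV. \<Sum>l\<in>UNIV. \<bar>C k l\<bar>)" for y k l
  proof -
    have "\<bar>A y $ k $ l\<bar> \<le> \<bar>C k l\<bar>" using C[where y = y and k = k and l = l] by linarith
    also have "\<dots> \<le> (\<Sum>l\<in>UNIV. \<bar>C k l\<bar>)" by (rule member_le_sum) auto
    also have "\<dots> \<le> (\<Sum>k\<in>UNIV. \<Sum>l\<in>UNIV. \<bar>C k l\<bar>)"
      by (rule member_le_sum[where f = "\<lambda>k. \<Sum>l\<in>UNIV. \<bar>C k l\<bar>"]) (auto intro: sum_nonneg)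
    finally show ?thesis .
  qed
  then show thesis by (rule that[rotated]) (intro sum_nonneg abs_ge_zero)
qed

text \<open>Averaging the pointwise energy bound: the pairing of \<open>A D\<close> with the approximating real gradient has
  mean zero, so the mean square of \<open>D\<close> is controlled by its distance to that gradient, which is
  arbitrarily small.\<close>
lemma energy_estimate:
  fixes A :: "real ^ 'd \<Rightarrow> real ^ 'd ^ 'd" and D :: "real ^ 'd \<Rightarrow> complex ^ 'd"
  assumes A: "\<And>k l. (\<lambda>y. A y $ k $ l) \<in> AP"
    and coercive: "\<alpha> > 0" "\<And>y v. (A y *v v) \<bullet> v \<ge> \<alpha> * (norm v)\<^sup>2"
    and D: "\<And>k. (\<lambda>y. D y $ k) \<in> L2_loc"
    and approx: "\<And>e. e > 0 \<Longrightarrow> \<exists>G. (\<forall>k. (\<lambda>y. complex_of_real (G y $ k)) \<in> L2_loc)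
        \<and> has_mean (\<lambda>y. cdot (cmat (A y) *v D y) (cvec (G y))) 0
        \<and> (\<forall>k. \<forall>\<^sub>F L in at_top. avg L (\<lambda>y. (cmod (D y $ k - complex_of_real (G y $ k)))\<^sup>2) < e)"
  shows "((\<lambda>L. avg L (\<lambda>y. (cmod (D y $ k))\<^sup>2)) \<longlongrightarrow> 0) at_top"
proof (rule tendstoI)
  fix r :: real assume "r > 0"
  obtain b where b: "b \<ge> 0" "\<And>y k l. \<bar>A y $ k $ l\<bar> \<le> b" using AP_entries_bounded[OF A] by metis
  define B where "B = real (CARD('d) * CARD('d)) * b"
  have "B \<ge> 0" using b by (simp add: B_def)
  define K where "K = \<alpha> + B + B\<^sup>2 / (2 * \<alpha>)"
  have "K > 0" unfolding K_def using \<open>B \<ge> 0\<close> coercive(1) by (intro add_pos_nonneg) auto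
  \<comment> \<open>Half of the budget \<open>\<alpha> / 2 * r\<close> is for the flux term, the other half is shared by the \<open>CARD('d)\<close>
        distances.\<close>
  define e where "e = \<alpha> / 4 * r / (K * CARD('d))"
  have e: "e > 0" "K * CARD('d) * e = \<alpha> / 4 * r"
    using \<open>K > 0\<close> \<open>r > 0\<close> coercive(1) by (simp_all add: e_def)
  obtain G where G: "\<And>k. (\<lambda>y. complex_of_real (G y $ k)) \<in> L2_loc"
    "has_mean (\<lambda>y. cdot (cmat (A y) *v D y) (cvec (G y))) 0"
    "\<And>k. \<forall>\<^sub>F L in at_top. avg L (\<lambda>y. (cmod (D y $ k - complex_of_real (G y $ k)))\<^sup>2) < e"
    using approx[OF e(1)] by blast
  let ?f = "\<lambda>y. cdot (cmat (A y) *v D y) (cvec (G y))"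
  let ?d = "\<lambda>k y. (cmod (D y $ k - complex_of_real (G y $ k)))\<^sup>2"
  have f: "loc_integrable ?f" using G(2) by (simp add: has_mean_def)
  have d: "loc_integrable (?d k)" for k by (intro L2_loc_loc_integrable_sq L2_loc_diff D G(1))
  have point: "\<alpha> / 2 * (cmod (D y $ k))\<^sup>2 \<le> Re (?f y) + K * (\<Sum>k\<in>UNIV. ?d k y)" for y
  proof -
    have "norm (cmat (A y) *v w) \<le> B * norm w" for w
      unfolding B_def using b(2) by (rule norm_cmat_vector_le)
    note energy_bound[OF coercive(1,2) this \<open>B \<ge> 0\<close>, of "D y" "G y", folded K_def]
    moreover have "(norm (D y - cvec (G y)))\<^sup>2 = (\<Sum>k\<in>UNIV. ?d k y)"
      by (simp add: norm_vec_sq cvec_def)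
    moreover have "\<alpha> / 2 * (cmod (D y $ k))\<^sup>2 \<le> \<alpha> / 2 * (norm (D y))\<^sup>2"
      using coercive(1) by (intro mult_left_mono power_mono Finite_Cartesian_Product.norm_nth_le) auto
    ultimately show ?thesis by simp
  qed
  have est: "\<alpha> / 2 * avg L (\<lambda>y. (cmod (D y $ k))\<^sup>2) \<le> Re (avg L ?f) + K * (\<Sum>k\<in>UNIV. avg L (?d k))" for L
  proof -
    have "\<alpha> / 2 * avg L (\<lambda>y. (cmod (D y $ k))\<^sup>2) = avg L (\<lambda>y. \<alpha> / 2 * (cmod (D y $ k))\<^sup>2)"
      by (rule avg_cmult[symmetric])
    also have "\<dots> \<le> avg L (\<lambda>y. Re (?f y) + K * (\<Sum>k\<in>UNIV. ?d k y))"
      by (intro avg_mono point loc_integrable_cmult L2_loc_loc_integrable_sq D loc_integrable_add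
          avg_Re_Im(3) f loc_integrable_sum d finite)
    also have "\<dots> = Re (avg L ?f) + K * (\<Sum>k\<in>UNIV. avg L (?d k))"
      by (subst avg_add) (auto intro!: loc_integrable_cmult loc_integrable_sum d avg_Re_Im(3) f
          simp: avg_cmult avg_sum d avg_Re_Im(1)[OF f])
    finally show ?thesis .
  qed
  have "\<forall>\<^sub>F L in at_top. \<forall>k. avg L (?d k) < e"
    using G(3) by (simp add: eventually_all_finite)
  moreover have "\<forall>\<^sub>F L in at_top. dist (avg L ?f) 0 < \<alpha> / 4 * r"
    using G(2) coercive(1) \<open>r > 0\<close> unfolding has_mean_def by (intro tendstoD) auto
  ultimately show "\<forall>\<^sub>F L in at_top. dist (avg L (\<lambda>y. (cmod (D y $ k))\<^sup>2)) 0 < r"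
  proof eventually_elim
    case (elim L)
    have "(\<Sum>k\<in>UNIV. avg L (?d k)) \<le> (\<Sum>k\<in>(UNIV :: 'd set). e)"
      using elim(1) by (intro sum_mono) (auto intro: less_imp_le)
    then have "(\<Sum>k\<in>UNIV. avg L (?d k)) \<le> CARD('d) * e" by simp
    then have "K * (\<Sum>k\<in>UNIV. avg L (?d k)) \<le> K * (CARD('d) * e)"
      using \<open>K > 0\<close> by (intro mult_left_mono) auto
    then have "K * (\<Sum>k\<in>UNIV. avg L (?d k)) \<le> \<alpha> / 4 * r"
      using e(2) by (simp only: mult.assoc)
    moreover have "Re (avg L ?f) < \<alpha> / 4 * r"
      using complex_Re_le_cmod[of "avg L ?f"] elim(2) by simp
    ultimately have "\<alpha> / 2 * avg L (\<lambda>y. (cmod (D y $ k))\<^sup>2) < \<alpha> / 2 * r"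
      using est[of L] by simp
    then show ?case using coercive(1) avg_nonneg[of "\<lambda>y. (cmod (D y $ k))\<^sup>2" L] by simp
  qed
qed

section \<open>Equality of the two correctors\<close>

theorem lemma6p3:
  fixes A :: "real ^ 'd \<Rightarrow> real ^ 'd ^ 'd"
    and \<xi> :: "real ^ 'd"
    and N NA :: "real ^ 'd \<Rightarrow> complex ^ 'd"
  assumes A_AP: "\<And>k l. (\<lambda>y. A y $ k $ l) \<in> AP"
    and A_sym: "\<And>y. transpose (A y) = A y"
    and A_coercive: "\<exists>\<alpha>>0. \<forall>v. AE y in lebesgue. (A y *v v) \<bullet> v \<ge> \<alpha> * (norm v)\<^sup>2"
    and NA_W: "NA \<in> W (Mod_mat A)"
    and NA_eq: "\<And>V. V \<in> W (Mod_mat A) \<Longrightarrow>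
          cmean (\<lambda>y. cdot (cmat (A y) *v NA y) (V y)) = - cmean (\<lambda>y. cdot (cvec (A y *v \<xi>)) (V y))"
    and N_W: "N \<in> W UNIV"
    and N_eq: "\<And>V. V \<in> W UNIV \<Longrightarrow>
          cmean (\<lambda>y. cdot (cmat (A y) *v N y) (V y)) = - cmean (\<lambda>y. cdot (cvec (A y *v \<xi>)) (V y))"
  shows "(\<forall>k. B2_eq (\<lambda>y. N y $ k) (\<lambda>y. NA y $ k)) \<and>
         (\<forall>k. (\<lambda>y. N y $ k) \<in> B2_sub (Mod_mat A)) \<and>
         Mod_vec N \<subseteq> Mod_mat A"
proof -
  have cont: "continuous_on UNIV (\<lambda>y. A y $ k $ l)" for k l
    using A_AP[of k l] by (simp add: AP_def)
  obtain \<alpha> where \<alpha>: "\<alpha> > 0" "\<And>v. AE y in lebesgue. (A y *v v) \<bullet> v \<ge> \<alpha> * (norm v)\<^sup>2"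
    using A_coercive by blast
  have coercive: "(A y *v v) \<bullet> v \<ge> \<alpha> * (norm v)\<^sup>2" for y v
    by (rule coercive_everywhere[OF cont \<alpha>(2)])
  define D where "D y = N y - NA y" for y
  have L2: "(\<lambda>y. N y $ k) \<in> L2_loc" "(\<lambda>y. NA y $ k) \<in> L2_loc" for k
    using W_L2_loc N_W NA_W by blast+
  have D_L2: "(\<lambda>y. D y $ k) \<in> L2_loc" for k
    using L2_loc_diff[OF L2] by (simp add: D_def)
  have orth: "has_mean (\<lambda>y. cdot (cmat (A y) *v D y) (cvec (G y))) 0" if "G \<in> gradients UNIV" for G
    using has_mean_diff[OF corrector_flux_mean_zero[OF A_AP N_W N_eq that] module_corrector_tests_all_gradients[OF A_AP NA_W NA_eq that]]
    by (simp add: D_def matrix_vector_right_distrib matrix_vector_mult_diff_distrib cdot_add_left cdot_diff_left)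
  have lim: "((\<lambda>L. avg L (\<lambda>y. (cmod (D y $ k))\<^sup>2)) \<longlongrightarrow> 0) at_top" for k
  proof (rule energy_estimate[OF A_AP \<alpha>(1) coercive D_L2])
    fix e :: real assume "e > 0"
    \<comment> \<open>Each of the two squared distances enters with a factor of two.\<close>
    define s where "s = sqrt (e / 4)"
    have s: "s > 0" "s\<^sup>2 = e / 4" using \<open>e > 0\<close> by (simp_all add: s_def)
    obtain G1 where G1: "G1 \<in> gradients UNIV"
      "\<And>k. B2_dist_sq (\<lambda>y. N y $ k) (\<lambda>y. complex_of_real (G1 y $ k)) < ereal (s\<^sup>2)"
      using W_approx[OF N_W s(1)] by blast
    obtain G2 where G2: "G2 \<in> gradients (Mod_mat A)"
      "\<And>k. B2_dist_sq (\<lambda>y. NA y $ k) (\<lambda>y. complex_of_real (G2 y $ k)) < ereal (s\<^sup>2)"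
      using W_approx[OF NA_W s(1)] by blast
    have G2': "G2 \<in> gradients UNIV" using gradients_mono[OF subset_UNIV] G2(1) by blast
    have gL: "(\<lambda>y. complex_of_real (G1 y $ k)) \<in> L2_loc" "(\<lambda>y. complex_of_real (G2 y $ k)) \<in> L2_loc" for k
      using ctrig_L2_loc gradients_component G1(1) G2' by blast+
    show "\<exists>G. (\<forall>k. (\<lambda>y. complex_of_real (G y $ k)) \<in> L2_loc)
        \<and> has_mean (\<lambda>y. cdot (cmat (A y) *v D y) (cvec (G y))) 0
        \<and> (\<forall>k. \<forall>\<^sub>F L in at_top. avg L (\<lambda>y. (cmod (D y $ k - complex_of_real (G y $ k)))\<^sup>2) < e)"
    proof (intro exI[of _ "\<lambda>y. G1 y - G2 y"] conjI allI)
      show "(\<lambda>y. complex_of_real ((G1 y - G2 y) $ k)) \<in> L2_loc" for k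
        using L2_loc_diff[OF gL] by simp
      show "has_mean (\<lambda>y. cdot (cmat (A y) *v D y) (cvec (G1 y - G2 y))) 0"
        using has_mean_diff[OF orth[OF G1(1)] orth[OF G2']] by (simp add: cvec_diff cdot_diff_right)
      fix k
      show "\<forall>\<^sub>F L in at_top. avg L (\<lambda>y. (cmod (D y $ k - complex_of_real ((G1 y - G2 y) $ k)))\<^sup>2) < e"
        using B2_dist_sq_lessD[OF G1(2)[of k]] B2_dist_sq_lessD[OF G2(2)[of k]]
      proof eventually_elim
        case (elim L)
        have "(\<lambda>y. (cmod (D y $ k - complex_of_real ((G1 y - G2 y) $ k)))\<^sup>2)
          = (\<lambda>y. (cmod ((N y $ k - complex_of_real (G1 y $ k)) - (NA y $ k - complex_of_real (G2 y $ k))))\<^sup>2)"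
          by (simp add: D_def algebra_simps)
        then show ?case
          using avg_diff_sq_le[OF L2_loc_diff[OF L2(1)[of k] gL(1)[of k]] L2_loc_diff[OF L2(2)[of k] gL(2)[of k]], of L] elim s(2)
          by simp
      qed
    qed
  qed
  have sub: "(\<lambda>y. N y $ k) \<in> B2_sub (Mod_mat A)" for k
    unfolding B2_sub_def mem_Collect_eq
  proof (intro conjI allI impI)
    show "(\<lambda>y. N y $ k) \<in> B2" using N_W by (simp add: W_def)
    fix e :: real assume "e > 0"
    \<comment> \<open>Doubled, the two errors \<open>(e / 2)\<^sup>2\<close> and \<open>e\<^sup>2 / 8\<close> add up to \<open>3 / 4 * e\<^sup>2\<close>.\<close>
    then have "e / 2 > 0" "e\<^sup>2 / 8 > 0" by simp_all
    then obtain G where G: "G \<in> gradients (Mod_mat A)"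
      "\<And>k. B2_dist_sq (\<lambda>y. NA y $ k) (\<lambda>y. complex_of_real (G y $ k)) < ereal ((e / 2)\<^sup>2)"
      using W_approx[OF NA_W] by metis
    have gL: "(\<lambda>y. complex_of_real (G y $ k)) \<in> L2_loc"
      using ctrig_L2_loc gradients_component G(1) by blast
    have "\<forall>\<^sub>F L in at_top. avg L (\<lambda>y. (cmod (D y $ k))\<^sup>2) < e\<^sup>2 / 8"
      using order_tendstoD(2)[OF lim \<open>e\<^sup>2 / 8 > 0\<close>] .
    then have "\<forall>\<^sub>F L in at_top. avg L (\<lambda>y. (cmod (N y $ k - complex_of_real (G y $ k)))\<^sup>2) \<le> 3 / 4 * e\<^sup>2"
      using B2_dist_sq_lessD[OF G(2)[of k]]
    proof eventually_elim
      case (elim L)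
      have "(\<lambda>y. (cmod (N y $ k - complex_of_real (G y $ k)))\<^sup>2)
        = (\<lambda>y. (cmod (D y $ k - (complex_of_real (G y $ k) - NA y $ k)))\<^sup>2)"
        by (simp add: D_def)
      moreover have "(\<lambda>y. (cmod (complex_of_real (G y $ k) - NA y $ k))\<^sup>2)
        = (\<lambda>y. (cmod (NA y $ k - complex_of_real (G y $ k)))\<^sup>2)"
        by (simp add: norm_minus_commute)
      ultimately show ?case
        using avg_diff_sq_le[OF D_L2[of k] L2_loc_diff[OF gL L2(2)[of k]], of L] elim
        by (simp add: power_divide)
    qed
    then have "B2_dist_sq (\<lambda>y. N y $ k) (\<lambda>y. complex_of_real (G y $ k)) \<le> ereal (3 / 4 * e\<^sup>2)"
      unfolding B2_dist_sq_def mean_avg by (intro Limsup_bounded) simp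
    also have "\<dots> < ereal (e\<^sup>2)" using \<open>e > 0\<close> by simp
    finally show "\<exists>\<phi>\<in>trig (Mod_mat A). B2_dist_sq (\<lambda>y. N y $ k) (\<lambda>y. complex_of_real (\<phi> y)) < ereal (e\<^sup>2)"
      using gradients_component[OF G(1), of k] by (intro bexI[of _ "\<lambda>y. G y $ k"]) (auto simp: trig_def)
  qed
  have "(\<lambda>y. N y $ k) \<in> mean_closure (Mod_mat A)" for k
    using sub[of k] by (intro mean_closureI_L2 L2(1)) (fastforce simp: B2_sub_def trig_def)
  then have "(\<Union>k. Lam (\<lambda>y. N y $ k)) \<subseteq> Mod_mat A"
    using Lam_mean_closure by blast
  then have "Mod_vec N \<subseteq> Mod_mat A"
    unfolding Mod_vec_def Mod_mat_def by (rule int_span_minimal)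
  moreover have "B2_eq (\<lambda>y. N y $ k) (\<lambda>y. NA y $ k)" for k
    using mean_eqI[OF lim[of k]] by (simp add: B2_eq_def B2_dist_sq_def D_def)
  ultimately show ?thesis using sub by blast
qed

end
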